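(* Let $\mathcal{T}$ be a rigidly-compactly generated tensor triangulated category that is tt-stratified. If $\operatorname{Spc}(\mathcal{T}^{\omega})$ is infinite, then there exists a prime ideal in $\mathcal{T}^{\omega}$ which cannot be generated by finitely many objects.
   Context: A tensor triangulated category (tt-category) is a triangulated category with a symmetric monoidal structure $(\otimes,\mathbb{1})$ whose tensor product is exact in each variable. A tt-category $\mathcal{T}$ (with arbitrary coproducts, preserved by $\otimes$ in each variable) is rigidly-compactly generated if it is compactly generated by its full subcategory $\mathcal{T}^{\omega}$ of compact objects and the compact objects coincide with the dualizable objects. Then $\mathcal{T}^{\omega}$ is an essentially small tt-category. An ideal in an essentially small tt-category $\mathcal{K}$ is a thick tensor ideal: a full triangulated subcategory closed under direct summands and under tensoring with arbitrary objects of $\mathcal{K}$; $\langle X_1,\dots,X_n\rangle_\otimes$ is the smallest ideal containing $X_1,\dots,X_n$. The radical of an ideal $\mathcal{I}$ is $\sqrt{\mathcal{I}}=\{x : x^{\otimes n}\in\mathcal{I}\text{ for some } n\geq 1\}$, and $\mathcal{I}$ is radical if $\sqrt{\mathcal{I}}=\mathcal{I}$. A radical ideal $\mathcal{I}$ is finitely generated (generated by finitely many objects) if $\mathcal{I}=\sqrt{\langle X_1,\dots,X_n\rangle_\otimes}$ for some finite collection $X_1,\dots,X_n\in\mathcal{K}$. (For $\mathcal{K}=\mathcal{T}^\omega$, which is rigid, all ideals are radical.) A prime ideal is a proper ideal $\mathcal{P}$ such that $x\otimes y\in\mathcal{P}$ implies $x\in\mathcal{P}$ or $y\in\mathcal{P}$;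 prime ideals are radical. The spectrum $\operatorname{Spc}(\mathcal{K})$ is the set of prime ideals with the topology having the sets $\operatorname{supp}(x)=\{\mathcal{P} : x\notin\mathcal{P}\}$, $x\in\mathcal{K}$, as a basis of closed subsets; it is a spectral space. A subset of a spectral space $X$ is Thomason if it is a union of complements of quasi-compact open subsets, and weakly visible if it has the form $W_1\cap (X\setminus W_2)$ with $W_1,W_2$ Thomason. Balmer–Favi–Sanders support: for each Thomason subset $Y\subseteq\operatorname{Spc}(\mathcal{T}^\omega)$ there is an exact triangle $e_Y\to\mathbb{1}\to f_Y\to\Sigma e_Y$ in $\mathcal{T}$, unique up to unique isomorphism, in which $e_Y$ lies in the localizing ideal $\mathcal{L}_Y$ generated by $\{x\in\mathcal{T}^\omega : \operatorname{supp}(x)\subseteq Y\}$ and $\operatorname{Hom}_{\mathcal{T}}(s,f_Y)=0$ for all $s\in\mathcal{L}_Y$. For a weakly visible subset $W=W_1\cap W_2^c$ with $W_1,W_2$ Thomason, set $g_W=e_{W_1}\otimes f_{W_2}$, which up to isomorphism depends only on $W$. For $t\in\mathcal{T}$, define $$\operatorname{Supp}(t)=\{\mathcal{P}\in\operatorname{Spc}(\mathcal{T}^\omega) : g_W\otimes t\neq 0\text{ for every weakly visible subset } W \text{ containing } \mathcal{P}\}.$$ A localizing ideal of $\mathcal{T}$ is a full triangulated subcategory closed under arbitrary coproducts and under tensoring with arbitrary objects of $\mathcal{T}$. $\mathcal{T}$ is tt-stratified if the map $\mathcal{L}\mapsto\operatorname{Supp}(\mathcal{L})=\bigcup_{t\in\mathcal{L}}\operatorname{Supp}(t)$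 is a bijection from the localizing ideals of $\mathcal{T}$ to the subsets of $\operatorname{Spc}(\mathcal{T}^\omega)$. *)

theory Defs
  imports "HOL-Algebra.FiniteProduct" "HOL-Analysis.Abstract_Topology"
begin

text \<open>Composition is written in the usual order: \<open>g \<cdot> f\<close> is first \<open>f\<close>, then \<open>g\<close>.\<close>

record ('o, 'm) category =
  obj :: "'o set"
  arr :: "'m set"
  src :: "'m \<Rightarrow> 'o"
  tgt :: "'m \<Rightarrow> 'o"
  ident :: "'o \<Rightarrow> 'm"
  cmp :: "'m \<Rightarrow> 'm \<Rightarrow> 'm"  (infixl \<open>\<cdot>\<index>\<close> 70)

definition Hom :: "('o, 'm, 'e) category_scheme \<Rightarrow> 'o \<Rightarrow> 'o \<Rightarrow> 'm set" where
  "Hom C a b = {f \<in> arr C. src C f = a \<and> tgt C f = b}"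

locale category =
  fixes C :: "('o, 'm, 'e) category_scheme" (structure)
  assumes src_obj: "f \<in> arr C \<Longrightarrow> src C f \<in> obj C"
    and tgt_obj: "f \<in> arr C \<Longrightarrow> tgt C f \<in> obj C"
    and ident_Hom: "a \<in> obj C \<Longrightarrow> ident C a \<in> Hom C a a"
    and cmp_Hom: "\<lbrakk>f \<in> Hom C a b; g \<in> Hom C b c\<rbrakk> \<Longrightarrow> g \<cdot> f \<in> Hom C a c"
    and cmp_ident: "f \<in> Hom C a b \<Longrightarrow> f \<cdot> ident C a = f"
    and ident_cmp: "f \<in> Hom C a b \<Longrightarrow> ident C b \<cdot> f = f"
    and cmp_assoc: "\<lbrakk>f \<in> Hom C a b; g \<in> Hom C b c; h \<in> Hom C c d\<rbrakk>
        \<Longrightarrow> (h \<cdot> g) \<cdot> f = h \<cdot> (g \<cdot> f)"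

definition inverse_mors :: "('o, 'm, 'e) category_scheme \<Rightarrow> 'm \<Rightarrow> 'm \<Rightarrow> bool" where
  "inverse_mors C f g \<longleftrightarrow> f \<in> arr C \<and> g \<in> Hom C (tgt C f) (src C f) \<and>
     g \<cdot>\<^bsub>C\<^esub> f = ident C (src C f) \<and> f \<cdot>\<^bsub>C\<^esub> g = ident C (tgt C f)"

definition iso :: "('o, 'm, 'e) category_scheme \<Rightarrow> 'm \<Rightarrow> bool" where
  "iso C f \<longleftrightarrow> (\<exists>g. inverse_mors C f g)"

definition inv_mor :: "('o, 'm, 'e) category_scheme \<Rightarrow> 'm \<Rightarrow> 'm" where
  "inv_mor C f = (THE g. inverse_mors C f g)"

definition isomorphic :: "('o, 'm, 'e) category_scheme \<Rightarrow> 'o \<Rightarrow> 'o \<Rightarrow> bool" where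
  "isomorphic C a b \<longleftrightarrow> (\<exists>f \<in> Hom C a b. iso C f)"

definition is_zero :: "('o, 'm, 'e) category_scheme \<Rightarrow> 'o \<Rightarrow> bool" where
  "is_zero C z \<longleftrightarrow> z \<in> obj C \<and> (\<forall>a \<in> obj C. (\<exists>!f. f \<in> Hom C z a) \<and> (\<exists>!f. f \<in> Hom C a z))"

definition is_coproduct ::
  "('o, 'm, 'e) category_scheme \<Rightarrow> 'i set \<Rightarrow> ('i \<Rightarrow> 'o) \<Rightarrow> 'o \<Rightarrow> ('i \<Rightarrow> 'm) \<Rightarrow> bool" where
  "is_coproduct C I X c \<iota> \<longleftrightarrow> c \<in> obj C \<and> (\<forall>i \<in> I. X i \<in> obj C \<and> \<iota> i \<in> Hom C (X i) c) \<and>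
     (\<forall>d \<in> obj C. \<forall>f. (\<forall>i \<in> I. f i \<in> Hom C (X i) d) \<longrightarrow>
        (\<exists>!h. h \<in> Hom C c d \<and> (\<forall>i \<in> I. h \<cdot>\<^bsub>C\<^esub> \<iota> i = f i)))"

definition endofunctor ::
  "('o, 'm, 'e) category_scheme \<Rightarrow> ('o \<Rightarrow> 'o) \<Rightarrow> ('m \<Rightarrow> 'm) \<Rightarrow> bool" where
  "endofunctor C FO FM \<longleftrightarrow> (\<forall>a \<in> obj C. FO a \<in> obj C \<and> FM (ident C a) = ident C (FO a)) \<and>
     (\<forall>a b. \<forall>f \<in> Hom C a b. FM f \<in> Hom C (FO a) (FO b)) \<and>
     (\<forall>a b c. \<forall>f \<in> Hom C a b. \<forall>g \<in> Hom C b c. FM (g \<cdot>\<^bsub>C\<^esub> f) = FM g \<cdot>\<^bsub>C\<^esub> FM f)"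

text \<open>A distinguished triangle \<open>x \<rightarrow> y \<rightarrow> z \<rightarrow> \<Sigma>x\<close> is recorded as its triple of morphisms.\<close>

record ('o, 'm) tri_category = "('o, 'm) category" +
  zero_mor :: "'o \<Rightarrow> 'o \<Rightarrow> 'm"
  madd :: "'m \<Rightarrow> 'm \<Rightarrow> 'm"
  shift_obj :: "'o \<Rightarrow> 'o"
  shift_mor :: "'m \<Rightarrow> 'm"
  triangles :: "('m \<times> 'm \<times> 'm) set"

definition hom_group :: "('o, 'm, 'e) tri_category_scheme \<Rightarrow> 'o \<Rightarrow> 'o \<Rightarrow> 'm monoid" where
  "hom_group C a b = \<lparr>carrier = Hom C a b, monoid.mult = madd C, one = zero_mor C a b\<rparr>"

definition neg_mor :: "('o, 'm, 'e) tri_category_scheme \<Rightarrow> 'm \<Rightarrow> 'm" where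
  "neg_mor C f = m_inv (hom_group C (src C f) (tgt C f)) f"

locale additive_category = category C
  for C :: "('o, 'm, 'e) tri_category_scheme" (structure) +
  assumes hom_comm_group: "\<lbrakk>a \<in> obj C; b \<in> obj C\<rbrakk> \<Longrightarrow> comm_group (hom_group C a b)"
    and cmp_madd: "\<lbrakk>f \<in> Hom C a b; f' \<in> Hom C a b; g \<in> Hom C b c\<rbrakk>
        \<Longrightarrow> g \<cdot> madd C f f' = madd C (g \<cdot> f) (g \<cdot> f')"
    and madd_cmp: "\<lbrakk>f \<in> Hom C a b; g \<in> Hom C b c; g' \<in> Hom C b c\<rbrakk>
        \<Longrightarrow> madd C g g' \<cdot> f = madd C (g \<cdot> f) (g' \<cdot> f)"
    and ex_zero: "\<exists>z. is_zero C z"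
    and ex_binary_coproduct: "\<lbrakk>a \<in> obj C; b \<in> obj C\<rbrakk>
        \<Longrightarrow> \<exists>c \<iota>. is_coproduct C UNIV (\<lambda>i::bool. if i then a else b) c \<iota>"

definition additive_endofunctor ::
  "('o, 'm, 'e) tri_category_scheme \<Rightarrow> ('o \<Rightarrow> 'o) \<Rightarrow> ('m \<Rightarrow> 'm) \<Rightarrow> bool" where
  "additive_endofunctor C FO FM \<longleftrightarrow> endofunctor C FO FM \<and>
     (\<forall>a b. \<forall>f \<in> Hom C a b. \<forall>g \<in> Hom C a b. FM (madd C f g) = madd C (FM f) (FM g))"

definition candidate_triangle ::
  "('o, 'm, 'e) tri_category_scheme \<Rightarrow> 'o \<Rightarrow> 'o \<Rightarrow> 'o \<Rightarrow> 'm \<Rightarrow> 'm \<Rightarrow> 'm \<Rightarrow> bool" where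
  "candidate_triangle C x y z f g h \<longleftrightarrow>
     f \<in> Hom C x y \<and> g \<in> Hom C y z \<and> h \<in> Hom C z (shift_obj C x)"

definition exact_triangle ::
  "('o, 'm, 'e) tri_category_scheme \<Rightarrow> 'o \<Rightarrow> 'o \<Rightarrow> 'o \<Rightarrow> 'm \<Rightarrow> 'm \<Rightarrow> 'm \<Rightarrow> bool" where
  "exact_triangle C x y z f g h \<longleftrightarrow> candidate_triangle C x y z f g h \<and> (f, g, h) \<in> triangles C"

locale triangulated_category = additive_category C
  for C :: "('o, 'm, 'e) tri_category_scheme" (structure) +
  assumes shift_functor: "additive_endofunctor C (shift_obj C) (shift_mor C)"
    and shift_fully_faithful: "\<lbrakk>a \<in> obj C; b \<in> obj C\<rbrakk>
        \<Longrightarrow> bij_betw (shift_mor C) (Hom C a b) (Hom C (shift_obj C a) (shift_obj C b))"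
    and shift_ess_surj: "b \<in> obj C \<Longrightarrow> \<exists>a \<in> obj C. isomorphic C (shift_obj C a) b"
    and triangles_candidate: "(f, g, h) \<in> triangles C
        \<Longrightarrow> \<exists>x y z. candidate_triangle C x y z f g h"
    and triangles_iso: "\<lbrakk>exact_triangle C x y z f g h; candidate_triangle C x' y' z' f' g' h';
          u \<in> Hom C x x'; v \<in> Hom C y y'; w \<in> Hom C z z'; iso C u; iso C v; iso C w;
          v \<cdot> f = f' \<cdot> u; w \<cdot> g = g' \<cdot> v; shift_mor C u \<cdot> h = h' \<cdot> w\<rbrakk>
        \<Longrightarrow> exact_triangle C x' y' z' f' g' h'"
    and triangles_ident: "\<lbrakk>a \<in> obj C; is_zero C z\<rbrakk>
        \<Longrightarrow> exact_triangle C a a z (ident C a) (zero_mor C a z) (zero_mor C z (shift_obj C a))"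
    and triangles_cone: "f \<in> Hom C x y \<Longrightarrow> \<exists>z g h. exact_triangle C x y z f g h"
    and triangles_rotate: "candidate_triangle C x y z f g h
        \<Longrightarrow> exact_triangle C x y z f g h \<longleftrightarrow>
            exact_triangle C y z (shift_obj C x) g h (neg_mor C (shift_mor C f))"
    and triangles_fill: "\<lbrakk>exact_triangle C x y z f g h; exact_triangle C x' y' z' f' g' h';
          u \<in> Hom C x x'; v \<in> Hom C y y'; v \<cdot> f = f' \<cdot> u\<rbrakk>
        \<Longrightarrow> \<exists>w \<in> Hom C z z'. w \<cdot> g = g' \<cdot> v \<and> shift_mor C u \<cdot> h = h' \<cdot> w"
    and octahedral: "\<lbrakk>exact_triangle C x y z' f i j; exact_triangle C y z x' g k l;
          exact_triangle C x z y' (g \<cdot> f) m n\<rbrakk>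
        \<Longrightarrow> \<exists>p q. exact_triangle C z' y' x' p q (shift_mor C i \<cdot> l) \<and>
              p \<cdot> i = m \<cdot> g \<and> n \<cdot> p = j \<and> q \<cdot> m = k \<and> l \<cdot> q = shift_mor C f \<cdot> n"

definition exact_endofunctor ::
  "('o, 'm, 'e) tri_category_scheme \<Rightarrow> ('o \<Rightarrow> 'o) \<Rightarrow> ('m \<Rightarrow> 'm) \<Rightarrow> bool" where
  "exact_endofunctor C FO FM \<longleftrightarrow> additive_endofunctor C FO FM \<and>
     (\<exists>\<phi>. (\<forall>x \<in> obj C. \<phi> x \<in> Hom C (FO (shift_obj C x)) (shift_obj C (FO x)) \<and> iso C (\<phi> x)) \<and>
        (\<forall>x y. \<forall>f \<in> Hom C x y.
           shift_mor C (FM f) \<cdot>\<^bsub>C\<^esub> \<phi> x = \<phi> y \<cdot>\<^bsub>C\<^esub> FM (shift_mor C f)) \<and>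
        (\<forall>x y z f g h. exact_triangle C x y z f g h \<longrightarrow>
           exact_triangle C (FO x) (FO y) (FO z) (FM f) (FM g) (\<phi> x \<cdot>\<^bsub>C\<^esub> FM h)))"

text \<open>
  The tensor product is written \<open>\<boxtimes>\<close> on objects and \<open>\<odot>\<close> on morphisms. The constraints have
  components \<open>assoc a b c : (a \<boxtimes> b) \<boxtimes> c \<rightarrow> a \<boxtimes> (b \<boxtimes> c)\<close>, \<open>lunit a : \<one> \<boxtimes> a \<rightarrow> a\<close>,
  \<open>runit a : a \<boxtimes> \<one> \<rightarrow> a\<close> and \<open>braid a b : a \<boxtimes> b \<rightarrow> b \<boxtimes> a\<close>.
\<close>

record ('o, 'm) tt_category = "('o, 'm) tri_category" +
  tunit :: "'o"
  tens_obj :: "'o \<Rightarrow> 'o \<Rightarrow> 'o"  (infixl \<open>\<boxtimes>\<index>\<close> 75)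
  tens_mor :: "'m \<Rightarrow> 'm \<Rightarrow> 'm"  (infixl \<open>\<odot>\<index>\<close> 75)
  assoc :: "'o \<Rightarrow> 'o \<Rightarrow> 'o \<Rightarrow> 'm"
  lunit :: "'o \<Rightarrow> 'm"
  runit :: "'o \<Rightarrow> 'm"
  braid :: "'o \<Rightarrow> 'o \<Rightarrow> 'm"

locale symmetric_monoidal_category = category C
  for C :: "('o, 'm, 'e) tt_category_scheme" (structure) +
  assumes tunit_obj: "tunit C \<in> obj C"
    and tens_obj: "\<lbrakk>a \<in> obj C; b \<in> obj C\<rbrakk> \<Longrightarrow> a \<boxtimes> b \<in> obj C"
    and tens_Hom: "\<lbrakk>f \<in> Hom C a b; g \<in> Hom C a' b'\<rbrakk> \<Longrightarrow> f \<odot> g \<in> Hom C (a \<boxtimes> a') (b \<boxtimes> b')"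
    and tens_ident: "\<lbrakk>a \<in> obj C; b \<in> obj C\<rbrakk> \<Longrightarrow> ident C a \<odot> ident C b = ident C (a \<boxtimes> b)"
    and tens_cmp: "\<lbrakk>f \<in> Hom C a b; g \<in> Hom C b c; f' \<in> Hom C a' b'; g' \<in> Hom C b' c'\<rbrakk>
        \<Longrightarrow> (g \<cdot> f) \<odot> (g' \<cdot> f') = (g \<odot> g') \<cdot> (f \<odot> f')"
    and assoc_iso: "\<lbrakk>a \<in> obj C; b \<in> obj C; c \<in> obj C\<rbrakk>
        \<Longrightarrow> assoc C a b c \<in> Hom C ((a \<boxtimes> b) \<boxtimes> c) (a \<boxtimes> (b \<boxtimes> c)) \<and> iso C (assoc C a b c)"
    and assoc_natural: "\<lbrakk>f \<in> Hom C a a'; g \<in> Hom C b b'; h \<in> Hom C c c'\<rbrakk>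
        \<Longrightarrow> assoc C a' b' c' \<cdot> ((f \<odot> g) \<odot> h) = (f \<odot> (g \<odot> h)) \<cdot> assoc C a b c"
    and lunit_iso: "a \<in> obj C \<Longrightarrow> lunit C a \<in> Hom C (tunit C \<boxtimes> a) a \<and> iso C (lunit C a)"
    and lunit_natural: "f \<in> Hom C a b
        \<Longrightarrow> lunit C b \<cdot> (ident C (tunit C) \<odot> f) = f \<cdot> lunit C a"
    and runit_iso: "a \<in> obj C \<Longrightarrow> runit C a \<in> Hom C (a \<boxtimes> tunit C) a \<and> iso C (runit C a)"
    and runit_natural: "f \<in> Hom C a b
        \<Longrightarrow> runit C b \<cdot> (f \<odot> ident C (tunit C)) = f \<cdot> runit C a"
    and braid_Hom: "\<lbrakk>a \<in> obj C; b \<in> obj C\<rbrakk> \<Longrightarrow> braid C a b \<in> Hom C (a \<boxtimes> b) (b \<boxtimes> a)"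
    and braid_natural: "\<lbrakk>f \<in> Hom C a a'; g \<in> Hom C b b'\<rbrakk>
        \<Longrightarrow> braid C a' b' \<cdot> (f \<odot> g) = (g \<odot> f) \<cdot> braid C a b"
    and braid_symmetric: "\<lbrakk>a \<in> obj C; b \<in> obj C\<rbrakk>
        \<Longrightarrow> braid C b a \<cdot> braid C a b = ident C (a \<boxtimes> b)"
    and pentagon: "\<lbrakk>a \<in> obj C; b \<in> obj C; c \<in> obj C; d \<in> obj C\<rbrakk>
        \<Longrightarrow> assoc C a b (c \<boxtimes> d) \<cdot> assoc C (a \<boxtimes> b) c d =
            (ident C a \<odot> assoc C b c d) \<cdot> assoc C a (b \<boxtimes> c) d \<cdot> (assoc C a b c \<odot> ident C d)"
    and triangle: "\<lbrakk>a \<in> obj C; b \<in> obj C\<rbrakk>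
        \<Longrightarrow> (ident C a \<odot> lunit C b) \<cdot> assoc C a (tunit C) b = runit C a \<odot> ident C b"
    and hexagon: "\<lbrakk>a \<in> obj C; b \<in> obj C; c \<in> obj C\<rbrakk>
        \<Longrightarrow> assoc C b c a \<cdot> braid C a (b \<boxtimes> c) \<cdot> assoc C a b c =
            (ident C b \<odot> braid C a c) \<cdot> assoc C b a c \<cdot> (braid C a b \<odot> ident C c)"

locale tt_category = triangulated_category C + symmetric_monoidal_category C
  for C :: "('o, 'm, 'e) tt_category_scheme" (structure) +
  assumes tens_exact_left: "a \<in> obj C
        \<Longrightarrow> exact_endofunctor C (\<lambda>x. a \<boxtimes> x) (\<lambda>f. ident C a \<odot> f)"
    and tens_exact_right: "a \<in> obj C
        \<Longrightarrow> exact_endofunctor C (\<lambda>x. x \<boxtimes> a) (\<lambda>f. f \<odot> ident C a)"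

definition full_subcategory ::
  "('o, 'm, 'e) tt_category_scheme \<Rightarrow> 'o set \<Rightarrow> ('o, 'm, 'e) tt_category_scheme" where
  "full_subcategory C S = C\<lparr>
     obj := S,
     arr := {f \<in> arr C. src C f \<in> S \<and> tgt C f \<in> S},
     triangles := {(f, g, h) \<in> triangles C. src C f \<in> S \<and> tgt C f \<in> S \<and> tgt C g \<in> S}\<rparr>"

definition dualizable :: "('o, 'm, 'e) tt_category_scheme \<Rightarrow> 'o \<Rightarrow> bool" where
  "dualizable C x \<longleftrightarrow> x \<in> obj C \<and>
     (\<exists>y \<in> obj C. \<exists>\<eta> \<in> Hom C (tunit C) (x \<boxtimes>\<^bsub>C\<^esub> y). \<exists>\<epsilon> \<in> Hom C (y \<boxtimes>\<^bsub>C\<^esub> x) (tunit C).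
        runit C x \<cdot>\<^bsub>C\<^esub> (ident C x \<odot>\<^bsub>C\<^esub> \<epsilon>) \<cdot>\<^bsub>C\<^esub> assoc C x y x \<cdot>\<^bsub>C\<^esub> (\<eta> \<odot>\<^bsub>C\<^esub> ident C x)
          = lunit C x \<and>
        lunit C y \<cdot>\<^bsub>C\<^esub> (\<epsilon> \<odot>\<^bsub>C\<^esub> ident C y) \<cdot>\<^bsub>C\<^esub> inv_mor C (assoc C y x y) \<cdot>\<^bsub>C\<^esub> (ident C y \<odot>\<^bsub>C\<^esub> \<eta>)
          = runit C y)"

definition triangulated_subcategory ::
  "('o, 'm, 'e) tri_category_scheme \<Rightarrow> 'o set \<Rightarrow> bool" where
  "triangulated_subcategory C S \<longleftrightarrow> S \<subseteq> obj C \<and> (\<exists>z \<in> S. is_zero C z) \<and>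
     (\<forall>x \<in> obj C. shift_obj C x \<in> S \<longleftrightarrow> x \<in> S) \<and>
     (\<forall>x y z f g h. exact_triangle C x y z f g h \<longrightarrow> x \<in> S \<longrightarrow> y \<in> S \<longrightarrow> z \<in> S)"

definition direct_summand :: "('o, 'm, 'e) category_scheme \<Rightarrow> 'o \<Rightarrow> 'o \<Rightarrow> bool" where
  "direct_summand C x y \<longleftrightarrow> x \<in> obj C \<and>
     (\<exists>x' \<in> obj C. \<exists>\<iota>. is_coproduct C UNIV (\<lambda>i::bool. if i then x else x') y \<iota>)"

text \<open>
  In \<open>thick_ideal\<close> and \<open>localizing_ideal\<close> tensoring on one side suffices by symmetry: the
  subcategories are closed under isomorphism, because they are closed under all choices of
  cones of \<open>0 \<rightarrow> x\<close>.
\<close>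

definition thick_ideal :: "('o, 'm, 'e) tt_category_scheme \<Rightarrow> 'o set \<Rightarrow> bool" where
  "thick_ideal K I \<longleftrightarrow> triangulated_subcategory K I \<and>
     (\<forall>x y. y \<in> I \<longrightarrow> direct_summand K x y \<longrightarrow> x \<in> I) \<and>
     (\<forall>x \<in> obj K. \<forall>y \<in> I. x \<boxtimes>\<^bsub>K\<^esub> y \<in> I)"

definition generated_ideal :: "('o, 'm, 'e) tt_category_scheme \<Rightarrow> 'o set \<Rightarrow> 'o set" where
  "generated_ideal K X = \<Inter>{I. thick_ideal K I \<and> X \<subseteq> I}"

fun tens_pow :: "('o, 'm, 'e) tt_category_scheme \<Rightarrow> 'o \<Rightarrow> nat \<Rightarrow> 'o" where
  "tens_pow K x 0 = tunit K"
| "tens_pow K x (Suc 0) = x"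
| "tens_pow K x (Suc (Suc n)) = tens_pow K x (Suc n) \<boxtimes>\<^bsub>K\<^esub> x"

definition radical :: "('o, 'm, 'e) tt_category_scheme \<Rightarrow> 'o set \<Rightarrow> 'o set" where
  "radical K I = {x \<in> obj K. \<exists>n \<ge> 1. tens_pow K x n \<in> I}"

definition finitely_generated :: "('o, 'm, 'e) tt_category_scheme \<Rightarrow> 'o set \<Rightarrow> bool" where
  "finitely_generated K I \<longleftrightarrow>
     (\<exists>X. finite X \<and> X \<subseteq> obj K \<and> I = radical K (generated_ideal K X))"

definition prime_ideal :: "('o, 'm, 'e) tt_category_scheme \<Rightarrow> 'o set \<Rightarrow> bool" where
  "prime_ideal K P \<longleftrightarrow> thick_ideal K P \<and> P \<noteq> obj K \<and>
     (\<forall>x \<in> obj K. \<forall>y \<in> obj K. x \<boxtimes>\<^bsub>K\<^esub> y \<in> P \<longrightarrow> x \<in> P \<or> y \<in> P)"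

definition Spc :: "('o, 'm, 'e) tt_category_scheme \<Rightarrow> 'o set set" where
  "Spc K = {P. prime_ideal K P}"

definition supp :: "('o, 'm, 'e) tt_category_scheme \<Rightarrow> 'o \<Rightarrow> 'o set set" where
  "supp K x = {P \<in> Spc K. x \<notin> P}"

definition Spc_topology :: "('o, 'm, 'e) tt_category_scheme \<Rightarrow> 'o set topology" where
  "Spc_topology K = topology (arbitrary union_of (\<lambda>U. \<exists>x \<in> obj K. U = Spc K - supp K x))"

definition thomason :: "'a topology \<Rightarrow> 'a set \<Rightarrow> bool" where
  "thomason X Y \<longleftrightarrow>
     (\<exists>\<U>. (\<forall>U \<in> \<U>. openin X U \<and> compactin X U) \<and> Y = (\<Union>U \<in> \<U>. topspace X - U))"

definition weakly_visible :: "'a topology \<Rightarrow> 'a set \<Rightarrow> bool" where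
  "weakly_visible X W \<longleftrightarrow>
     (\<exists>W1 W2. thomason X W1 \<and> thomason X W2 \<and> W = W1 \<inter> (topspace X - W2))"

text \<open>
  Small sets are modelled by a cardinal \<open>\<kappa>\<close>: a set is small if its cardinality is \<open>< \<kappa>\<close>. When
  \<open>\<kappa>\<close> is the cardinality of a Grothendieck universe (i.e. inaccessible), this is smallness with
  respect to that universe. HOL does not prove that an inaccessible cardinal exists, so \<open>\<kappa>\<close> is
  only required to be uncountable and regular. Index sets may be taken inside the type \<open>'k\<close>
  without loss, since every small set is equipotent to a subset of \<open>Field \<kappa>\<close>.
\<close>

context includes cardinal_syntax begin

definition small :: "'k rel \<Rightarrow> 'a set \<Rightarrow> bool" where
  "small \<kappa> A \<longleftrightarrow> |A| <o \<kappa>"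

definition smallness_cardinal :: "'k rel \<Rightarrow> bool" where
  "smallness_cardinal \<kappa> \<longleftrightarrow> Card_order \<kappa> \<and> natLeq <o \<kappa> \<and> regularCard \<kappa>"

end

text \<open>
  Since small sets need not be closed under power sets for a general regular \<open>\<kappa>\<close>, essential
  smallness asks for a set \<open>S\<close> of representatives whose power set is small. For inaccessible \<open>\<kappa>\<close>
  this is the same as \<open>S\<close> being small.
\<close>

definition essentially_small :: "'k rel \<Rightarrow> ('o, 'm, 'e) category_scheme \<Rightarrow> bool" where
  "essentially_small \<kappa> C \<longleftrightarrow>
     (\<exists>S \<subseteq> obj C. small \<kappa> (Pow S) \<and> (\<forall>x \<in> obj C. \<exists>s \<in> S. isomorphic C x s)) \<and>
     (\<forall>a \<in> obj C. \<forall>b \<in> obj C. small \<kappa> (Hom C a b))"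

text \<open>
  \<open>x\<close> is compact if, for every small coproduct \<open>c\<close> of a family \<open>X\<close>, the canonical map
  \<open>\<Oplus>\<^sub>i Hom(x, X i) \<rightarrow> Hom(x, c)\<close> is bijective; the direct sum consists of the finitely supported
  families, and \<open>finprod\<close> is the sum in the abelian group \<open>Hom(x, c)\<close>.
\<close>

definition compact_object ::
  "'k rel \<Rightarrow> ('o, 'm, 'e) tri_category_scheme \<Rightarrow> 'o \<Rightarrow> bool" where
  "compact_object \<kappa> T x \<longleftrightarrow> x \<in> obj T \<and>
     (\<forall>(I::'k set) X c \<iota>. small \<kappa> I \<longrightarrow> is_coproduct T I X c \<iota> \<longrightarrow>
        bij_betw (\<lambda>g. finprod (hom_group T x c) (\<lambda>i. \<iota> i \<cdot>\<^bsub>T\<^esub> g i)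
                        {i \<in> I. g i \<noteq> zero_mor T x (X i)})
          {g \<in> \<Pi>\<^sub>E i \<in> I. Hom T x (X i). finite {i \<in> I. g i \<noteq> zero_mor T x (X i)}}
          (Hom T x c))"

definition compact_part ::
  "'k rel \<Rightarrow> ('o, 'm, 'e) tt_category_scheme \<Rightarrow> ('o, 'm, 'e) tt_category_scheme" where
  "compact_part \<kappa> T = full_subcategory T {x. compact_object \<kappa> T x}"

locale rigidly_compactly_generated = tt_category T
  for \<kappa> :: "'k rel" and T :: "('o, 'm, 'e) tt_category_scheme" (structure) +
  assumes smallness: "smallness_cardinal \<kappa>"
    and small_homs: "\<lbrakk>a \<in> obj T; b \<in> obj T\<rbrakk> \<Longrightarrow> small \<kappa> (Hom T a b)"
    and ex_coproduct: "\<lbrakk>small \<kappa> (I::'k set); \<forall>i \<in> I. X i \<in> obj T\<rbrakk>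
        \<Longrightarrow> \<exists>c \<iota>. is_coproduct T I X c \<iota>"
    and tens_coproduct_left: "\<lbrakk>small \<kappa> (I::'k set); is_coproduct T I X c \<iota>; a \<in> obj T\<rbrakk>
        \<Longrightarrow> is_coproduct T I (\<lambda>i. a \<boxtimes> X i) (a \<boxtimes> c) (\<lambda>i. ident T a \<odot> \<iota> i)"
    and tens_coproduct_right: "\<lbrakk>small \<kappa> (I::'k set); is_coproduct T I X c \<iota>; a \<in> obj T\<rbrakk>
        \<Longrightarrow> is_coproduct T I (\<lambda>i. X i \<boxtimes> a) (c \<boxtimes> a) (\<lambda>i. \<iota> i \<odot> ident T a)"
    and compact_essentially_small: "essentially_small \<kappa> (compact_part \<kappa> T)"
    and compacts_generate: "\<lbrakk>t \<in> obj T;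
          \<forall>x. compact_object \<kappa> T x \<longrightarrow> Hom T x t = {zero_mor T x t}\<rbrakk> \<Longrightarrow> is_zero T t"
    and compact_iff_dualizable: "compact_object \<kappa> T x \<longleftrightarrow> dualizable T x"

definition localizing_ideal :: "'k rel \<Rightarrow> ('o, 'm, 'e) tt_category_scheme \<Rightarrow> 'o set \<Rightarrow> bool" where
  "localizing_ideal \<kappa> T L \<longleftrightarrow> triangulated_subcategory T L \<and>
     (\<forall>(I::'k set) X c \<iota>. small \<kappa> I \<longrightarrow> is_coproduct T I X c \<iota> \<longrightarrow> (\<forall>i \<in> I. X i \<in> L) \<longrightarrow> c \<in> L) \<and>
     (\<forall>x \<in> obj T. \<forall>y \<in> L. x \<boxtimes>\<^bsub>T\<^esub> y \<in> L)"

definition loc_supported_on ::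
  "'k rel \<Rightarrow> ('o, 'm, 'e) tt_category_scheme \<Rightarrow> 'o set set \<Rightarrow> 'o set" where
  "loc_supported_on \<kappa> T Y = \<Inter>{L. localizing_ideal \<kappa> T L \<and>
     {x \<in> obj (compact_part \<kappa> T). supp (compact_part \<kappa> T) x \<subseteq> Y} \<subseteq> L}"

text \<open>
  \<open>e\<close> and \<open>f\<close> are the outer terms of an idempotent triangle \<open>e \<rightarrow> \<one> \<rightarrow> f \<rightarrow> \<Sigma>e\<close> for \<open>Y\<close>. They are
  determined up to isomorphism only, so \<open>e\<^sub>Y\<close>, \<open>f\<^sub>Y\<close> and \<open>g\<^sub>W\<close> are rendered as relations, and
  \<open>g\<^sub>W \<otimes> t \<noteq> 0\<close> is asserted for every choice of \<open>g\<^sub>W\<close>.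
\<close>

definition idempotent_triangle ::
  "'k rel \<Rightarrow> ('o, 'm, 'e) tt_category_scheme \<Rightarrow> 'o set set \<Rightarrow> 'o \<Rightarrow> 'o \<Rightarrow> bool" where
  "idempotent_triangle \<kappa> T Y e f \<longleftrightarrow>
     (\<exists>u v w. exact_triangle T e (tunit T) f u v w) \<and>
     e \<in> loc_supported_on \<kappa> T Y \<and>
     (\<forall>s \<in> loc_supported_on \<kappa> T Y. Hom T s f = {zero_mor T s f})"

definition is_g :: "'k rel \<Rightarrow> ('o, 'm, 'e) tt_category_scheme \<Rightarrow> 'o set set \<Rightarrow> 'o \<Rightarrow> bool" where
  "is_g \<kappa> T W g \<longleftrightarrow> (\<exists>W1 W2 e1 f1 e2 f2.
     thomason (Spc_topology (compact_part \<kappa> T)) W1 \<and>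
     thomason (Spc_topology (compact_part \<kappa> T)) W2 \<and>
     W = W1 \<inter> (topspace (Spc_topology (compact_part \<kappa> T)) - W2) \<and>
     idempotent_triangle \<kappa> T W1 e1 f1 \<and> idempotent_triangle \<kappa> T W2 e2 f2 \<and>
     g = e1 \<boxtimes>\<^bsub>T\<^esub> f2)"

definition Supp :: "'k rel \<Rightarrow> ('o, 'm, 'e) tt_category_scheme \<Rightarrow> 'o \<Rightarrow> 'o set set" where
  "Supp \<kappa> T t = {P \<in> Spc (compact_part \<kappa> T).
     \<forall>W. weakly_visible (Spc_topology (compact_part \<kappa> T)) W \<longrightarrow> P \<in> W \<longrightarrow>
       (\<forall>g. is_g \<kappa> T W g \<longrightarrow> \<not> is_zero T (g \<boxtimes>\<^bsub>T\<^esub> t))}"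

definition tt_stratified :: "'k rel \<Rightarrow> ('o, 'm, 'e) tt_category_scheme \<Rightarrow> bool" where
  "tt_stratified \<kappa> T \<longleftrightarrow>
     bij_betw (\<lambda>L. \<Union>t \<in> L. Supp \<kappa> T t) {L. localizing_ideal \<kappa> T L}
       (Pow (Spc (compact_part \<kappa> T)))"

end

theory Submission
  imports Defs "HOL-Analysis.Function_Topology"
begin

text \<open>
  Stratification forces every point \<open>P\<close> of the spectrum to be weakly visible. For each prime \<open>Q\<close>
  choose \<open>t\<^sub>Q\<close> with \<open>Supp(t\<^sub>Q) = {Q}\<close> inside a localizing ideal supported on \<open>{Q}\<close>. Then
  \<open>t\<^sub>P \<otimes> t\<^sub>Q\<close> has empty support for \<open>Q \<noteq> P\<close>, hence vanishes. If every weakly visible set through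
  \<open>P\<close> met another point, the coproduct of the \<open>t\<^sub>Q\<close> with \<open>Q \<noteq> P\<close> would have \<open>P\<close> in its support, so
  the localizing ideal of objects annihilated by \<open>t\<^sub>P\<close> would have full support, and \<open>t\<^sub>P = 0\<close>.

  Now let a weakly visible point \<open>P\<close> be finitely generated. The primes containing \<open>P\<close> are those that
  contain its finitely many generators, so \<open>{P}\<close> is cut out by membership or non-membership of
  finitely many objects: \<open>P\<close> is isolated in the constructible topology. That topology is compact,
  so an infinite spectrum contains a prime that is not isolated.

  All that matters about \<open>g\<^sub>W\<close> is that \<open>g\<^sub>W \<otimes> -\<close> has a localizing ideal as its kernel.
\<close>

subsection \<open>Categories and additive categories\<close>

context category
begin

lemma HomD:
  assumes "f \<in> Hom C a b"
  shows "f \<in> arr C" "src C f = a" "tgt C f = b" "a \<in> obj C" "b \<in> obj C"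
  using assms src_obj tgt_obj by (auto simp: Hom_def)

lemma isoE:
  assumes "iso C f" "f \<in> Hom C a b"
  obtains g where "g \<in> Hom C b a" "g \<cdot> f = ident C a" "f \<cdot> g = ident C b" "iso C g"
proof -
  obtain g where g: "inverse_mors C f g"
    using assms(1) by (auto simp: iso_def)
  then have "inverse_mors C g f"
    using assms(2) by (auto simp: inverse_mors_def Hom_def)
  with g show thesis
    using assms(2) that by (auto simp: inverse_mors_def Hom_def iso_def)
qed

lemma isoI:
  assumes "f \<in> Hom C a b" "g \<in> Hom C b a" "g \<cdot> f = ident C a" "f \<cdot> g = ident C b"
  shows "iso C f"
  using assms by (auto simp: inverse_mors_def Hom_def iso_def)

lemma inverse_unique:
  assumes "f \<in> Hom C a b" "g \<in> Hom C b a" "g' \<in> Hom C b a"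
    and "g \<cdot> f = ident C a" "f \<cdot> g' = ident C b"
  shows "g = g'"
  using cmp_assoc[OF assms(3,1,2)] assms(4,5) cmp_ident[OF assms(2)] ident_cmp[OF assms(3)] by simp

text \<open>\<open>inv_mor\<close> is a definite description, so its value is usable only once
  inverses are known to be unique. The value is needed for the inverse associator in
  \<open>dualizable\<close>.\<close>

lemma inv_mor_eq:
  assumes "f \<in> Hom C a b" "g \<in> Hom C b a" "g \<cdot> f = ident C a" "f \<cdot> g = ident C b"
  shows "inv_mor C f = g"
  unfolding inv_mor_def
proof (rule the_equality)
  show "inverse_mors C f g"
    using assms by (auto simp: inverse_mors_def Hom_def)
  fix g' assume "inverse_mors C f g'"
  then have "g' \<in> Hom C b a" "g' \<cdot> f = ident C a"
    using HomD[OF assms(1)] by (auto simp: inverse_mors_def)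
  then show "g' = g"
    using inverse_unique assms by blast
qed

lemma iso_ident: "a \<in> obj C \<Longrightarrow> iso C (ident C a)"
  using ident_Hom cmp_ident isoI by metis

lemma isomorphic_sym: "isomorphic C a b \<Longrightarrow> isomorphic C b a"
  unfolding isomorphic_def by (meson isoE)

lemma iso_cmp:
  assumes "iso C f" "f \<in> Hom C a b" "iso C g" "g \<in> Hom C b c"
  shows "iso C (g \<cdot> f)"
proof -
  obtain f' where f': "f' \<in> Hom C b a" "f' \<cdot> f = ident C a" "f \<cdot> f' = ident C b"
    using assms isoE by metis
  obtain g' where g': "g' \<in> Hom C c b" "g' \<cdot> g = ident C b" "g \<cdot> g' = ident C c"
    using assms isoE by metis
  show ?thesis
  proof (rule isoI)
    show "g \<cdot> f \<in> Hom C a c" "f' \<cdot> g' \<in> Hom C c a"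
      using assms f' g' cmp_Hom by blast+
    have "f' \<cdot> g' \<cdot> (g \<cdot> f) = f' \<cdot> (g' \<cdot> (g \<cdot> f))"
      using cmp_assoc[OF cmp_Hom[OF assms(2,4)] g'(1) f'(1)] .
    also have "g' \<cdot> (g \<cdot> f) = f"
      using cmp_assoc[OF assms(2,4) g'(1)] g'(2) ident_cmp[OF assms(2)] by simp
    finally show "f' \<cdot> g' \<cdot> (g \<cdot> f) = ident C a"
      using f'(2) by simp
    have "g \<cdot> f \<cdot> (f' \<cdot> g') = g \<cdot> (f \<cdot> (f' \<cdot> g'))"
      using cmp_assoc[OF cmp_Hom[OF g'(1) f'(1)] assms(2,4)] .
    also have "f \<cdot> (f' \<cdot> g') = g'"
      using cmp_assoc[OF g'(1) f'(1) assms(2)] f'(3) ident_cmp[OF g'(1)] by simp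
    finally show "g \<cdot> f \<cdot> (f' \<cdot> g') = ident C c"
      using g'(3) by simp
  qed
qed

lemma isomorphic_trans [trans]:
  "\<lbrakk>isomorphic C a b; isomorphic C b c\<rbrakk> \<Longrightarrow> isomorphic C a c"
  unfolding isomorphic_def by (meson iso_cmp cmp_Hom)

lemma iso_cancel_left:
  assumes "iso C h" "h \<in> Hom C b c" "f \<in> Hom C a b" "g \<in> Hom C a b" "h \<cdot> f = h \<cdot> g"
  shows "f = g"
proof -
  obtain k where k: "k \<in> Hom C c b" "k \<cdot> h = ident C b"
    using isoE assms by metis
  have "f = k \<cdot> (h \<cdot> f)"
    using cmp_assoc[OF assms(3,2) k(1)] k(2) ident_cmp[OF assms(3)] by simp
  also have "\<dots> = g"
    unfolding assms(5) using cmp_assoc[OF assms(4,2) k(1)] k(2) ident_cmp[OF assms(4)] by simp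
  finally show ?thesis .
qed

lemma iso_cancel_right:
  assumes "iso C h" "h \<in> Hom C a b" "f \<in> Hom C b c" "g \<in> Hom C b c" "f \<cdot> h = g \<cdot> h"
  shows "f = g"
proof -
  obtain k where k: "k \<in> Hom C b a" "h \<cdot> k = ident C b"
    using isoE assms by metis
  have "f = f \<cdot> h \<cdot> k"
    using cmp_assoc[OF k(1) assms(2,3)] k(2) cmp_ident[OF assms(3)] by simp
  also have "\<dots> = g"
    unfolding assms(5) using cmp_assoc[OF k(1) assms(2,4)] k(2) cmp_ident[OF assms(4)] by simp
  finally show ?thesis .
qed

lemma coproduct_cotuple:
  assumes "is_coproduct C I X c \<iota>" "d \<in> obj C" "\<And>i. i \<in> I \<Longrightarrow> f i \<in> Hom C (X i) d"
  obtains h where "h \<in> Hom C c d" "\<And>i. i \<in> I \<Longrightarrow> h \<cdot> \<iota> i = f i"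
  using assms unfolding is_coproduct_def by (metis (no_types, lifting))

lemma coproduct_eqI:
  assumes "is_coproduct C I X c \<iota>" "h \<in> Hom C c d" "h' \<in> Hom C c d"
    and "\<And>i. i \<in> I \<Longrightarrow> h \<cdot> \<iota> i = h' \<cdot> \<iota> i"
  shows "h = h'"
proof -
  have "d \<in> obj C"
    using HomD(5) assms(2) .
  moreover have "\<forall>i\<in>I. h \<cdot> \<iota> i \<in> Hom C (X i) d"
    using assms(1) cmp_Hom[OF _ assms(2)] by (simp add: is_coproduct_def)
  ultimately have "\<exists>!k. k \<in> Hom C c d \<and> (\<forall>i\<in>I. k \<cdot> \<iota> i = h \<cdot> \<iota> i)"
    using assms(1) unfolding is_coproduct_def by (auto dest!: bspec spec[where x="\<lambda>i. h \<cdot> \<iota> i"])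
  then show ?thesis
    using assms by metis
qed

lemma coproduct_obj: "is_coproduct C I X c \<iota> \<Longrightarrow> c \<in> obj C"
  and coproduct_component: "\<lbrakk>is_coproduct C I X c \<iota>; i \<in> I\<rbrakk> \<Longrightarrow> \<iota> i \<in> Hom C (X i) c"
  by (auto simp: is_coproduct_def)

text \<open>In \<open>direct_summand\<close> the summand occupies the slot \<open>True\<close>, so
  the second summand has to be moved there.\<close>

lemma binary_coproduct_swap:
  assumes "is_coproduct C UNIV (\<lambda>i::bool. if i then a else b) c \<iota>"
  shows "is_coproduct C UNIV (\<lambda>i::bool. if i then b else a) c (\<lambda>i. \<iota> (\<not> i))"
  unfolding is_coproduct_def
proof (intro conjI allI impI ballI)
  show "c \<in> obj C"
    using assms by (simp add: is_coproduct_def)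
  show "(if i then b else a) \<in> obj C" "\<iota> (\<not> i) \<in> Hom C (if i then b else a) c" for i
    using assms by (auto simp: is_coproduct_def split: if_splits)
  fix d f assume "d \<in> obj C" and f: "\<forall>i\<in>UNIV. f i \<in> Hom C (if i then b else a) d"
  moreover have "\<forall>i\<in>UNIV. f (\<not> i) \<in> Hom C (if i then a else b) d"
    using f by (metis UNIV_I)
  ultimately have "\<exists>!h. h \<in> Hom C c d \<and> (\<forall>i\<in>UNIV. h \<cdot> \<iota> i = f (\<not> i))"
    using assms unfolding is_coproduct_def by (auto dest!: spec[where x="\<lambda>i. f (\<not> i)"])
  moreover have "(\<forall>i\<in>UNIV. h \<cdot> \<iota> i = f (\<not> i)) \<longleftrightarrow> (\<forall>i\<in>UNIV. h \<cdot> \<iota> (\<not> i) = f i)" for h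
    by (auto simp: all_bool_eq)
  ultimately show "\<exists>!h. h \<in> Hom C c d \<and> (\<forall>i\<in>UNIV. h \<cdot> \<iota> (\<not> i) = f i)"
    by simp
qed

end

section \<open>Zero morphisms, zero objects and coproducts in additive categories\<close>

context additive_category
begin

lemma zero_mor_Hom: "\<lbrakk>a \<in> obj C; b \<in> obj C\<rbrakk> \<Longrightarrow> zero_mor C a b \<in> Hom C a b"
  using monoid.one_closed[OF group.axioms(1)[OF comm_group.axioms(2)[OF hom_comm_group]], of a b]
  by (simp add: hom_group_def)

lemma madd_Hom: "\<lbrakk>f \<in> Hom C a b; g \<in> Hom C a b\<rbrakk> \<Longrightarrow> madd C f g \<in> Hom C a b"
  using monoid.m_closed[OF group.axioms(1)[OF comm_group.axioms(2)[OF hom_comm_group]], of a b f g]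
    HomD[of f a b]
  by (simp add: hom_group_def)

lemma madd_cancel:
  assumes "f \<in> Hom C a b" "g \<in> Hom C a b" "madd C f g = f"
  shows "g = zero_mor C a b"
proof -
  interpret G: comm_group "hom_group C a b"
    using assms HomD hom_comm_group by blast
  show ?thesis
    using G.l_cancel_one[of f g] assms by (simp add: hom_group_def)
qed

lemma madd_zero:
  assumes "f \<in> Hom C a b"
  shows "madd C f (zero_mor C a b) = f" "madd C (zero_mor C a b) f = f"
proof -
  interpret G: comm_group "hom_group C a b"
    using assms HomD hom_comm_group by blast
  show "madd C f (zero_mor C a b) = f" "madd C (zero_mor C a b) f = f"
    using G.r_one[of f] G.l_one[of f] assms by (simp_all add: hom_group_def)
qed

text \<open>Additivity makes the composite equal to its own double, and in a group only the zero
  element is.\<close>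

lemma cmp_zero_mor:
  assumes "g \<in> Hom C b c" "a \<in> obj C"
  shows "g \<cdot> zero_mor C a b = zero_mor C a c"
proof -
  have z: "zero_mor C a b \<in> Hom C a b"
    using assms HomD zero_mor_Hom by blast
  have "madd C (g \<cdot> zero_mor C a b) (g \<cdot> zero_mor C a b) = g \<cdot> zero_mor C a b"
    using cmp_madd[OF z z assms(1)] madd_zero(1)[OF z] by simp
  then show ?thesis
    using madd_cancel cmp_Hom[OF z assms(1)] by blast
qed

lemma zero_mor_cmp:
  assumes "f \<in> Hom C a b" "c \<in> obj C"
  shows "zero_mor C b c \<cdot> f = zero_mor C a c"
proof -
  have z: "zero_mor C b c \<in> Hom C b c"
    using assms HomD zero_mor_Hom by blast
  have "madd C (zero_mor C b c \<cdot> f) (zero_mor C b c \<cdot> f) = zero_mor C b c \<cdot> f"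
    using madd_cmp[OF assms(1) z z] madd_zero(1)[OF z] by simp
  then show ?thesis
    using madd_cancel cmp_Hom[OF assms(1) z] by blast
qed

lemma neg_mor:
  assumes "f \<in> Hom C a b"
  shows "neg_mor C f \<in> Hom C a b" "madd C f (neg_mor C f) = zero_mor C a b"
proof -
  interpret G: comm_group "hom_group C a b"
    using assms HomD hom_comm_group by blast
  have f: "f \<in> carrier (hom_group C a b)"
    using assms by (simp add: hom_group_def)
  show "neg_mor C f \<in> Hom C a b" "madd C f (neg_mor C f) = zero_mor C a b"
    using G.inv_closed[OF f] G.r_inv[OF f] HomD[OF assms]
    by (simp_all add: hom_group_def neg_mor_def)
qed

text \<open>Vanishing of an object becomes an equation between morphisms, which retractions and
  additive functors carry along.\<close>

lemma is_zero_iff: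
  assumes "z \<in> obj C"
  shows "is_zero C z \<longleftrightarrow> ident C z = zero_mor C z z"
proof
  assume "is_zero C z"
  then show "ident C z = zero_mor C z z"
    unfolding is_zero_def using assms ident_Hom zero_mor_Hom by metis
next
  assume e: "ident C z = zero_mor C z z"
  have "f = zero_mor C z a" if "f \<in> Hom C z a" for f a
    using that assms cmp_ident cmp_zero_mor e by metis
  moreover have "f = zero_mor C a z" if "f \<in> Hom C a z" for f a
    using that assms ident_cmp zero_mor_cmp e by metis
  ultimately show "is_zero C z"
    unfolding is_zero_def using assms zero_mor_Hom by metis
qed

lemma is_zero_obj: "is_zero C z \<Longrightarrow> z \<in> obj C"
  by (simp add: is_zero_def)

lemma Hom_from_zero: "\<lbrakk>is_zero C z; f \<in> Hom C z a\<rbrakk> \<Longrightarrow> f = zero_mor C z a"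
  using is_zero_iff is_zero_obj cmp_ident cmp_zero_mor by metis


lemma is_zero_retract:
  assumes "is_zero C c" "f \<in> Hom C a c" "g \<in> Hom C c a" "g \<cdot> f = ident C a"
  shows "is_zero C a"
  by (metis HomD(4) Hom_from_zero assms is_zero_iff zero_mor_cmp)

lemma is_zero_isomorphic: "\<lbrakk>isomorphic C a b; is_zero C a\<rbrakk> \<Longrightarrow> is_zero C b"
  unfolding isomorphic_def by (meson is_zero_retract isoE)

lemma is_zero_isomorphic_iff: "isomorphic C a b \<Longrightarrow> is_zero C a \<longleftrightarrow> is_zero C b"
  using is_zero_isomorphic isomorphic_sym by blast

lemma zero_isomorphic_zero: "\<lbrakk>is_zero C a; is_zero C b\<rbrakk> \<Longrightarrow> isomorphic C a b"
  unfolding isomorphic_def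
  using isoI[of "zero_mor C a b" a b "zero_mor C b a"] zero_mor_Hom cmp_zero_mor is_zero_obj is_zero_iff
  by metis

lemma is_zero_functor:
  assumes "additive_endofunctor C FO FM" "is_zero C z"
  shows "is_zero C (FO z)"
proof -
  have z: "z \<in> obj C" "zero_mor C z z \<in> Hom C z z"
    using assms is_zero_obj zero_mor_Hom by blast+
  have m: "FM (zero_mor C z z) \<in> Hom C (FO z) (FO z)"
    using assms(1) z by (auto simp: additive_endofunctor_def endofunctor_def)
  have "madd C (FM (zero_mor C z z)) (FM (zero_mor C z z)) = FM (madd C (zero_mor C z z) (zero_mor C z z))"
    using assms(1) z(2) unfolding additive_endofunctor_def by metis
  then have "FM (zero_mor C z z) = zero_mor C (FO z) (FO z)"
    using madd_zero[OF z(2)] madd_cancel[OF m m] by simp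
  then show ?thesis
    using assms z by (auto simp: is_zero_iff additive_endofunctor_def endofunctor_def)
qed

lemma coproduct_of_zeros:
  assumes "is_coproduct C I X c \<iota>" "\<And>i. i \<in> I \<Longrightarrow> is_zero C (X i)"
  shows "is_zero C c"
proof -
  have c: "c \<in> obj C"
    using assms coproduct_obj by blast
  have "ident C c \<cdot> \<iota> i = zero_mor C c c \<cdot> \<iota> i" if "i \<in> I" for i
    by (metis assms that c Hom_from_zero coproduct_component ident_cmp zero_mor_cmp)
  then show ?thesis
    using coproduct_eqI[OF assms(1) ident_Hom zero_mor_Hom] c is_zero_iff by blast
qed

text \<open>The cotuple of the identity at \<open>i\<close> and zero maps elsewhere. It makes each
  component a retract, so a vanishing coproduct has vanishing components.\<close>

lemma coproduct_projection:
  assumes "is_coproduct C I X c \<iota>" "i \<in> I"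
  obtains p where "p \<in> Hom C c (X i)" "p \<cdot> \<iota> i = ident C (X i)"
    "\<And>j. \<lbrakk>j \<in> I; j \<noteq> i\<rbrakk> \<Longrightarrow> p \<cdot> \<iota> j = zero_mor C (X j) (X i)"
proof -
  have o: "X j \<in> obj C" if "j \<in> I" for j
    using assms(1) that by (simp add: is_coproduct_def)
  have "(if j = i then ident C (X i) else zero_mor C (X j) (X i)) \<in> Hom C (X j) (X i)" if "j \<in> I" for j
    using o that assms(2) by (simp add: ident_Hom zero_mor_Hom)
  from coproduct_cotuple[OF assms(1) o[OF assms(2)] this]
  obtain p where "p \<in> Hom C c (X i)"
    "\<And>j. j \<in> I \<Longrightarrow> p \<cdot> \<iota> j = (if j = i then ident C (X i) else zero_mor C (X j) (X i))"
    by blast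
  then show thesis
    using that assms(2) by simp
qed

lemma coproduct_zero_component:
  assumes "is_coproduct C I X c \<iota>" "i \<in> I" "is_zero C c"
  shows "is_zero C (X i)"
  by (metis assms coproduct_component coproduct_projection is_zero_retract)

end

subsection \<open>Triangulated categories\<close>

context triangulated_category
begin

lemma shift_Hom: "f \<in> Hom C a b \<Longrightarrow> shift_mor C f \<in> Hom C (shift_obj C a) (shift_obj C b)"
  using shift_functor by (auto simp: additive_endofunctor_def endofunctor_def)

lemma shift_obj: "a \<in> obj C \<Longrightarrow> shift_obj C a \<in> obj C"
  using shift_functor by (auto simp: additive_endofunctor_def endofunctor_def)

lemma shift_cmp:
  "\<lbrakk>f \<in> Hom C a b; g \<in> Hom C b c\<rbrakk> \<Longrightarrow> shift_mor C (g \<cdot> f) = shift_mor C g \<cdot> shift_mor C f"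
  using shift_functor by (auto simp: additive_endofunctor_def endofunctor_def)

lemma shift_ident: "a \<in> obj C \<Longrightarrow> shift_mor C (ident C a) = ident C (shift_obj C a)"
  using shift_functor by (auto simp: additive_endofunctor_def endofunctor_def)

lemma is_zero_shift: "is_zero C z \<Longrightarrow> is_zero C (shift_obj C z)"
  using is_zero_functor shift_functor by blast

lemma shift_zero:
  assumes "a \<in> obj C" "b \<in> obj C"
  shows "shift_mor C (zero_mor C a b) = zero_mor C (shift_obj C a) (shift_obj C b)"
proof -
  have z: "zero_mor C a b \<in> Hom C a b"
    using assms zero_mor_Hom by blast
  have "madd C (shift_mor C (zero_mor C a b)) (shift_mor C (zero_mor C a b))
      = shift_mor C (madd C (zero_mor C a b) (zero_mor C a b))"
    using shift_functor z unfolding additive_endofunctor_def by metis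
  then show ?thesis
    using madd_cancel shift_Hom[OF z] madd_zero[OF z] by metis
qed

text \<open>Faithfulness of the shift reflects the equation between the identity and the zero
  map.\<close>

lemma is_zero_shift_iff:
  assumes "a \<in> obj C"
  shows "is_zero C (shift_obj C a) \<longleftrightarrow> is_zero C a"
proof
  assume "is_zero C (shift_obj C a)"
  then have "shift_mor C (ident C a) = shift_mor C (zero_mor C a a)"
    using assms is_zero_iff shift_ident shift_obj shift_zero by metis
  then show "is_zero C a"
    using shift_fully_faithful[OF assms assms] assms is_zero_iff ident_Hom zero_mor_Hom
    unfolding bij_betw_def inj_on_def by blast
qed (rule is_zero_shift)

lemma exact_triangleD:
  assumes "exact_triangle C x y z f g h"
  shows "f \<in> Hom C x y" "g \<in> Hom C y z" "h \<in> Hom C z (shift_obj C x)"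
  using assms by (auto simp: exact_triangle_def candidate_triangle_def)

lemma exact_rotate:
  "exact_triangle C x y z f g h
    \<Longrightarrow> exact_triangle C y z (shift_obj C x) g h (neg_mor C (shift_mor C f))"
  using triangles_rotate unfolding exact_triangle_def by blast

text \<open>One rotation turns this into a triangle from \<open>a\<close> to \<open>b\<close> to the
  shift of \<open>z\<close>, which is isomorphic to the identity triangle on \<open>a\<close> via
  identity, \<open>u\<close>, identity. Closure under isomorphism and \<open>exact_factor\<close>
  rest on it.\<close>

lemma exact_triangle_iso:
  assumes "u \<in> Hom C a b" "iso C u" "is_zero C z"
  shows "exact_triangle C z a b (zero_mor C z a) u (zero_mor C b (shift_obj C z))"
proof -
  note ab = HomD[OF assms(1)]
  have z: "z \<in> obj C" "is_zero C (shift_obj C z)" "shift_obj C z \<in> obj C"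
    using assms is_zero_obj is_zero_shift shift_obj by blast+
  have "exact_triangle C a b (shift_obj C z) u (zero_mor C b (shift_obj C z))
      (zero_mor C (shift_obj C z) (shift_obj C a))"
  proof (rule triangles_iso[OF triangles_ident[OF ab(4) z(2)]])
    show "candidate_triangle C a b (shift_obj C z) u (zero_mor C b (shift_obj C z))
        (zero_mor C (shift_obj C z) (shift_obj C a))"
      using ab z assms by (simp add: candidate_triangle_def zero_mor_Hom shift_obj)
    show "ident C a \<in> Hom C a a" "u \<in> Hom C a b"
      "ident C (shift_obj C z) \<in> Hom C (shift_obj C z) (shift_obj C z)"
      using ab z assms by (simp_all add: ident_Hom)
    show "iso C (ident C a)" "iso C u" "iso C (ident C (shift_obj C z))"
      using ab z assms by (simp_all add: iso_ident)
    show "u \<cdot> ident C a = u \<cdot> ident C a" ..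
    show "ident C (shift_obj C z) \<cdot> zero_mor C a (shift_obj C z) = zero_mor C b (shift_obj C z) \<cdot> u"
      using ab z assms(1) zero_mor_cmp zero_mor_Hom ident_cmp by metis
    show "shift_mor C (ident C a) \<cdot> zero_mor C (shift_obj C z) (shift_obj C a) =
      zero_mor C (shift_obj C z) (shift_obj C a) \<cdot> ident C (shift_obj C z)"
      using ab z shift_ident cmp_ident ident_cmp zero_mor_Hom shift_obj by metis
  qed
  \<comment> \<open>The map starts at the shift of \<open>z\<close>, a zero object, so the sign
    disappears.\<close>
  moreover have "neg_mor C (shift_mor C (zero_mor C z a)) = zero_mor C (shift_obj C z) (shift_obj C a)"
    using ab z Hom_from_zero neg_mor(1) shift_Hom zero_mor_Hom by meson
  moreover have "candidate_triangle C z a b (zero_mor C z a) u (zero_mor C b (shift_obj C z))"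
    using ab z assms by (simp add: candidate_triangle_def zero_mor_Hom)
  ultimately show ?thesis
    using triangles_rotate by metis
qed

text \<open>The weak cokernel property: \<open>k\<close> extends to a map into the triangle whose
  terms are a zero object, \<open>w\<close> and \<open>w\<close>, and the filler is the
  factorization.\<close>

lemma exact_factor:
  assumes "exact_triangle C x y z f g h" "k \<in> Hom C y w" "k \<cdot> f = zero_mor C x w"
  obtains m where "m \<in> Hom C z w" "m \<cdot> g = k"
proof -
  note t = exact_triangleD[OF assms(1)]
  obtain n where n: "is_zero C n"
    using ex_zero by blast
  have o: "n \<in> obj C" "w \<in> obj C" "x \<in> obj C"
    using n is_zero_obj HomD assms(2) t by blast+
  have "exact_triangle C n w w (zero_mor C n w) (ident C w) (zero_mor C w (shift_obj C n))"
    using exact_triangle_iso[OF ident_Hom iso_ident n] o by blast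
  moreover have "k \<cdot> f = zero_mor C n w \<cdot> zero_mor C x n"
    using assms(3) zero_mor_cmp zero_mor_Hom o by metis
  ultimately obtain m where "m \<in> Hom C z w" "m \<cdot> g = ident C w \<cdot> k"
    using triangles_fill[OF assms(1) _ zero_mor_Hom assms(2)] o by blast
  then show thesis
    using that ident_cmp assms(2) by metis
qed

text \<open>Comparison with the identity triangle on \<open>x\<close>, whose third term is zero,
  factors the composite through a zero object.\<close>

lemma exact_cmp_zero:
  assumes "exact_triangle C x y z f g h"
  shows "g \<cdot> f = zero_mor C x z"
proof -
  note t = exact_triangleD[OF assms]
  obtain n where n: "is_zero C n"
    using ex_zero by blast
  have o: "n \<in> obj C" "z \<in> obj C" "x \<in> obj C"
    using n is_zero_obj HomD t by blast+
  obtain w where "w \<in> Hom C n z" "w \<cdot> zero_mor C x n = g \<cdot> f"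
    using triangles_fill[OF triangles_ident[OF o(3) n] assms ident_Hom[OF o(3)] t(1)] by blast
  then show ?thesis
    using cmp_zero_mor o by metis
qed

text \<open>Since \<open>y\<close> vanishes, the identity of \<open>z\<close> kills \<open>g\<close>
  and factors through \<open>h\<close>, which makes \<open>z\<close> a retract of the shift of
  \<open>x\<close>.\<close>

lemma exact_zero_third:
  assumes "exact_triangle C x y z f g h" "is_zero C x" "is_zero C y"
  shows "is_zero C z"
proof -
  note t = exact_triangleD[OF assms(1)]
  have z: "z \<in> obj C" "y \<in> obj C"
    using HomD t by blast+
  have "ident C z \<cdot> g = zero_mor C y z"
    using Hom_from_zero assms(3) t(2) ident_cmp by metis
  with exact_factor[OF exact_rotate[OF assms(1)] ident_Hom[OF z(1)]]
  obtain m where "m \<in> Hom C (shift_obj C x) z" "m \<cdot> h = ident C z"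
    by blast
  then show ?thesis
    using is_zero_retract t(3) is_zero_shift assms(2) by blast
qed

text \<open>The cone \<open>w\<close> of the inclusion of \<open>x\<close> is identified with
  \<open>y\<close>: the projection \<open>q\<close> induces \<open>k\<close> from \<open>w\<close>
  to \<open>y\<close>, and its inverse \<open>j\<close> is the inclusion of \<open>y\<close>
  followed by \<open>g\<close>.\<close>

lemma split_triangle:
  assumes "is_coproduct C UNIV (\<lambda>i::bool. if i then x else y) c \<iota>"
  shows "\<exists>f g h. exact_triangle C x c y f g h"
proof -
  have i: "\<iota> True \<in> Hom C x c" "\<iota> False \<in> Hom C y c" and c: "c \<in> obj C"
    using coproduct_component[OF assms, of True] coproduct_component[OF assms, of False]
      coproduct_obj[OF assms] by simp_all
  have o: "x \<in> obj C" "y \<in> obj C"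
    using HomD i by blast+
  obtain p where p: "p \<in> Hom C c x" "p \<cdot> \<iota> True = ident C x" "p \<cdot> \<iota> False = zero_mor C y x"
  proof (rule coproduct_projection[OF assms UNIV_I[of True]])
    fix p assume "p \<in> Hom C c (if True then x else y)"
      "p \<cdot> \<iota> True = ident C (if True then x else y)"
      "\<And>j. \<lbrakk>j \<in> UNIV; j \<noteq> True\<rbrakk>
        \<Longrightarrow> p \<cdot> \<iota> j = zero_mor C (if j then x else y) (if True then x else y)"
    note this(1,2) this(3)[of False]
    then show thesis using that[of p] by simp
  qed
  obtain q where q: "q \<in> Hom C c y" "q \<cdot> \<iota> False = ident C y" "q \<cdot> \<iota> True = zero_mor C x y"
  proof (rule coproduct_projection[OF assms UNIV_I[of False]])
    fix p assume "p \<in> Hom C c (if False then x else y)"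
      "p \<cdot> \<iota> False = ident C (if False then x else y)"
      "\<And>j. \<lbrakk>j \<in> UNIV; j \<noteq> False\<rbrakk>
        \<Longrightarrow> p \<cdot> \<iota> j = zero_mor C (if j then x else y) (if False then x else y)"
    note this(1,2) this(3)[of True]
    then show thesis using that[of p] by simp
  qed
  obtain w g h where t: "exact_triangle C x c w (\<iota> True) g h"
    using triangles_cone i by blast
  note tD = exact_triangleD[OF t]
  have w: "w \<in> obj C"
    using HomD tD by blast
  \<comment> \<open>Two rotations show that the shifted inclusion of \<open>x\<close> composed with
    \<open>h\<close> is zero up to sign. The shift of \<open>p\<close> splits that inclusion, so
    \<open>h\<close> itself vanishes.\<close>
  have h0: "h = zero_mor C w (shift_obj C x)"
  proof -
    define s where "s = shift_mor C (\<iota> True)"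
    have s: "s \<in> Hom C (shift_obj C x) (shift_obj C c)"
      unfolding s_def using shift_Hom i by blast
    have "neg_mor C s \<cdot> h = zero_mor C w (shift_obj C c)"
      using exact_cmp_zero[OF exact_rotate[OF exact_rotate[OF t]]] by (simp add: s_def)
    moreover have "madd C (s \<cdot> h) (neg_mor C s \<cdot> h) = zero_mor C w (shift_obj C c)"
      using madd_cmp[OF tD(3) s neg_mor(1)[OF s]] neg_mor(2)[OF s] zero_mor_cmp[OF tD(3)] c shift_obj
      by simp
    ultimately have "s \<cdot> h = zero_mor C w (shift_obj C c)"
      using madd_zero cmp_Hom s tD(3) by metis
    then have "shift_mor C p \<cdot> (s \<cdot> h) = zero_mor C w (shift_obj C x)"
      using cmp_zero_mor shift_Hom p w by metis
    moreover have "shift_mor C p \<cdot> (s \<cdot> h) = h"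
      using cmp_assoc[OF tD(3) s shift_Hom[OF p(1)]] shift_cmp[OF i(1) p(1)] p(2) shift_ident o
        ident_cmp tD(3) by (metis s_def)
    ultimately show ?thesis
      by simp
  qed
  obtain k where k: "k \<in> Hom C w y" "k \<cdot> g = q"
    using exact_factor[OF t q(1,3)] by blast
  define j where "j = g \<cdot> \<iota> False"
  have j: "j \<in> Hom C y w"
    unfolding j_def using cmp_Hom i tD by blast
  have kj: "k \<cdot> j = ident C y"
    unfolding j_def using cmp_assoc[OF i(2) tD(2) k(1)] k(2) q(2) by simp
  have jkg: "(j \<cdot> k) \<cdot> g = g"
  proof (rule coproduct_eqI[OF assms])
    show "j \<cdot> k \<cdot> g \<in> Hom C c w" "g \<in> Hom C c w"
      using cmp_Hom j k tD by blast+
    fix i' :: bool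
    have e: "j \<cdot> k \<cdot> g = j \<cdot> q"
      using cmp_assoc[OF tD(2) k(1) j] k(2) by simp
    have "j \<cdot> q \<cdot> \<iota> True = g \<cdot> \<iota> True"
      using cmp_assoc[OF i(1) q(1) j] q(3) exact_cmp_zero[OF t] cmp_zero_mor[OF j o(1)] by simp
    moreover have "j \<cdot> q \<cdot> \<iota> False = g \<cdot> \<iota> False"
      using cmp_assoc[OF i(2) q(1) j] q(2) cmp_ident[OF j] by (simp add: j_def)
    ultimately show "j \<cdot> k \<cdot> g \<cdot> \<iota> i' = g \<cdot> \<iota> i'"
      using e by (cases i') simp_all
  qed
  \<comment> \<open>\<open>g\<close> is not known to be epi, so it cannot be cancelled in
    \<open>jkg\<close>. The difference \<open>d\<close> kills \<open>g\<close>, hence factors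
    through \<open>h = 0\<close>.\<close>
  have jk: "j \<cdot> k = ident C w"
  proof -
    define d where "d = madd C (j \<cdot> k) (neg_mor C (ident C w))"
    have I: "ident C w \<in> Hom C w w" and N: "neg_mor C (ident C w) \<in> Hom C w w"
      and JK: "j \<cdot> k \<in> Hom C w w"
      using ident_Hom neg_mor w cmp_Hom j k by blast+
    have d: "d \<in> Hom C w w"
      unfolding d_def using JK N madd_Hom by blast
    have "d \<cdot> g = madd C g (neg_mor C (ident C w) \<cdot> g)"
      unfolding d_def using madd_cmp[OF tD(2) JK N] jkg by simp
    also have "\<dots> = madd C (ident C w) (neg_mor C (ident C w)) \<cdot> g"
      using madd_cmp[OF tD(2) I N] ident_cmp[OF tD(2)] by simp
    also have "\<dots> = zero_mor C c w"
      using neg_mor(2)[OF I] zero_mor_cmp[OF tD(2) w] by simp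
    finally obtain m where "m \<in> Hom C (shift_obj C x) w" "m \<cdot> h = d"
      using exact_factor[OF exact_rotate[OF t] d] by blast
    then have "d = zero_mor C w w"
      using h0 cmp_zero_mor w by metis
    interpret G: comm_group "hom_group C w w"
      using w hom_comm_group by blast
    have "j \<cdot> k = inv\<^bsub>hom_group C w w\<^esub> (neg_mor C (ident C w))"
      using G.inv_equality[of "j \<cdot> k" "neg_mor C (ident C w)"] JK N \<open>d = zero_mor C w w\<close>
      by (simp add: hom_group_def d_def)
    also have "\<dots> = ident C w"
      using G.inv_inv[of "ident C w"] I HomD[OF I] by (simp add: neg_mor_def hom_group_def)
    finally show ?thesis .
  qed
  have "exact_triangle C x c y (\<iota> True) q (zero_mor C y (shift_obj C x))"
  proof (rule triangles_iso[OF t])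
    show "candidate_triangle C x c y (\<iota> True) q (zero_mor C y (shift_obj C x))"
      using i q o shift_obj zero_mor_Hom by (simp add: candidate_triangle_def)
    show "ident C x \<in> Hom C x x" "ident C c \<in> Hom C c c" "k \<in> Hom C w y"
      using ident_Hom o c k by blast+
    show "iso C (ident C x)" "iso C (ident C c)" "iso C k"
      using iso_ident o c isoI k(1) j jk kj by blast+
    show "ident C c \<cdot> \<iota> True = \<iota> True \<cdot> ident C x"
      using ident_cmp cmp_ident i by metis
    show "k \<cdot> g = q \<cdot> ident C c"
      using k q cmp_ident by metis
    show "shift_mor C (ident C x) \<cdot> h = zero_mor C y (shift_obj C x) \<cdot> k"
      using h0 shift_ident o ident_cmp tD(3) zero_mor_cmp k(1) shift_obj by metis
  qed
  then show ?thesis by blast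
qed

text \<open>\<open>\<phi>\<close> identifies the image of a shift with the shift of the image, and
  an exact triangle whose first two terms vanish has a vanishing third term.\<close>

lemma kernel_triangulated:
  assumes "exact_endofunctor C FO FM"
  shows "triangulated_subcategory C {s \<in> obj C. is_zero C (FO s)}"
proof -
  obtain \<phi> where add: "additive_endofunctor C FO FM"
    and \<phi>: "\<forall>x \<in> obj C. \<phi> x \<in> Hom C (FO (shift_obj C x)) (shift_obj C (FO x)) \<and> iso C (\<phi> x)"
    and ex: "\<forall>x y z f g h. exact_triangle C x y z f g h \<longrightarrow>
           exact_triangle C (FO x) (FO y) (FO z) (FM f) (FM g) (\<phi> x \<cdot> FM h)"
    using assms unfolding exact_endofunctor_def by (elim conjE exE) (rule that)
  have "isomorphic C (FO (shift_obj C x)) (shift_obj C (FO x))" if "x \<in> obj C" for x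
    unfolding isomorphic_def using \<phi> that by blast
  moreover have "FO x \<in> obj C" if "x \<in> obj C" for x
    using add that by (simp add: additive_endofunctor_def endofunctor_def)
  ultimately have "is_zero C (FO (shift_obj C x)) \<longleftrightarrow> is_zero C (FO x)" if "x \<in> obj C" for x
    using that is_zero_isomorphic_iff is_zero_shift_iff by metis
  moreover have "\<exists>z \<in> obj C. is_zero C z \<and> is_zero C (FO z)"
    using ex_zero is_zero_functor[OF add] is_zero_obj by blast
  moreover have "z \<in> obj C \<and> is_zero C (FO z)"
    if "exact_triangle C x y z f g h" "is_zero C (FO x)" "is_zero C (FO y)" for x y z f g h
    using exact_zero_third[OF ex[rule_format, OF that(1)] that(2,3)]
      HomD(5)[OF exact_triangleD(2)[OF that(1)]] by blast
  ultimately show ?thesis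
    unfolding triangulated_subcategory_def using shift_obj by auto
qed

end

text \<open>The shift is an equivalence, so its universal property can be unshifted to that of
  \<open>c\<close>. The result is used to see that shifted direct sums of compact objects are
  compact.\<close>

lemma (in triangulated_category) shift_coproduct:
  assumes c: "is_coproduct C I X c \<iota>"
  shows "is_coproduct C I (\<lambda>i. shift_obj C (X i)) (shift_obj C c) (\<lambda>i. shift_mor C (\<iota> i))"
  unfolding is_coproduct_def
proof (intro conjI ballI allI impI)
  have co: "c \<in> obj C" and X: "\<And>i. i \<in> I \<Longrightarrow> X i \<in> obj C"
    and \<iota>: "\<And>i. i \<in> I \<Longrightarrow> \<iota> i \<in> Hom C (X i) c"
    using c by (auto simp: is_coproduct_def)
  then show "shift_obj C c \<in> obj C" "\<And>i. i \<in> I \<Longrightarrow> shift_obj C (X i) \<in> obj C"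
    "\<And>i. i \<in> I \<Longrightarrow> shift_mor C (\<iota> i) \<in> Hom C (shift_obj C (X i)) (shift_obj C c)"
    using shift_obj shift_Hom by blast+
  fix d f assume d: "d \<in> obj C" and f: "\<forall>i\<in>I. f i \<in> Hom C (shift_obj C (X i)) d"
  \<comment> \<open>Up to the isomorphism \<open>v\<close> the target is a shift. Then
    \<open>lift\<close> yields existence and \<open>faithful\<close> uniqueness of unshifted
    maps.\<close>
  obtain a v where a: "a \<in> obj C" and v: "v \<in> Hom C (shift_obj C a) d" "iso C v"
    using shift_ess_surj[OF d] by (auto simp: isomorphic_def)
  have lift: "\<exists>g \<in> Hom C b a. v \<cdot> shift_mor C g = k" if k: "k \<in> Hom C (shift_obj C b) d" and b: "b \<in> obj C" for b k
  proof -
    obtain w where w: "w \<in> Hom C d (shift_obj C a)" "v \<cdot> w = ident C d"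
      using isoE[OF v(2,1)] by blast
    obtain g where g: "g \<in> Hom C b a" "shift_mor C g = w \<cdot> k"
      using shift_fully_faithful[OF b a] cmp_Hom[OF k w(1)] unfolding bij_betw_def by (metis imageE)
    have "v \<cdot> shift_mor C g = k"
      using g(2) cmp_assoc[OF k w(1) v(1)] w(2) ident_cmp[OF k] by simp
    then show ?thesis
      using g(1) by blast
  qed
  have faithful: "g = g'" if g: "g \<in> Hom C b a" "g' \<in> Hom C b a"
    and e: "v \<cdot> shift_mor C g = v \<cdot> shift_mor C g'" for b g g'
    using iso_cancel_left[OF v(2,1) shift_Hom[OF g(1)] shift_Hom[OF g(2)] e] g
      shift_fully_faithful[OF HomD(4)[OF g(1)] a] unfolding bij_betw_def inj_on_def by blast
  have cmp: "v \<cdot> shift_mor C (h \<cdot> \<iota> i) = v \<cdot> shift_mor C h \<cdot> shift_mor C (\<iota> i)"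
    if "h \<in> Hom C c a" "i \<in> I" for h i
    using shift_cmp[OF \<iota>[OF that(2)] that(1)]
      cmp_assoc[OF shift_Hom[OF \<iota>[OF that(2)]] shift_Hom[OF that(1)] v(1)] by simp
  have "\<forall>i\<in>I. \<exists>g. g \<in> Hom C (X i) a \<and> v \<cdot> shift_mor C g = f i"
    using lift f X by blast
  then obtain g where g: "\<And>i. i \<in> I \<Longrightarrow> g i \<in> Hom C (X i) a" "\<And>i. i \<in> I \<Longrightarrow> v \<cdot> shift_mor C (g i) = f i"
    by metis
  obtain h where h: "h \<in> Hom C c a" "\<And>i. i \<in> I \<Longrightarrow> h \<cdot> \<iota> i = g i"
    using coproduct_cotuple[OF c a g(1)] by blast
  show "\<exists>!h. h \<in> Hom C (shift_obj C c) d \<and> (\<forall>i\<in>I. h \<cdot> shift_mor C (\<iota> i) = f i)"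
  proof (rule ex1I[of _ "v \<cdot> shift_mor C h"])
    show "v \<cdot> shift_mor C h \<in> Hom C (shift_obj C c) d \<and> (\<forall>i\<in>I. v \<cdot> shift_mor C h \<cdot> shift_mor C (\<iota> i) = f i)"
      using cmp_Hom[OF shift_Hom[OF h(1)] v(1)] cmp[OF h(1)] h(2) g(2) by simp
    fix k assume k: "k \<in> Hom C (shift_obj C c) d \<and> (\<forall>i\<in>I. k \<cdot> shift_mor C (\<iota> i) = f i)"
    then obtain h' where h': "h' \<in> Hom C c a" "v \<cdot> shift_mor C h' = k"
      using lift co by blast
    have "h' \<cdot> \<iota> i = h \<cdot> \<iota> i" if i: "i \<in> I" for i
    proof (rule faithful)
      show "h' \<cdot> \<iota> i \<in> Hom C (X i) a" "h \<cdot> \<iota> i \<in> Hom C (X i) a"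
        using cmp_Hom[OF \<iota>[OF i]] h' h by blast+
      show "v \<cdot> shift_mor C (h' \<cdot> \<iota> i) = v \<cdot> shift_mor C (h \<cdot> \<iota> i)"
        using cmp[OF h'(1) i] cmp[OF h(1) i] h'(2) k i h(2)[OF i] g(2)[OF i] by simp
    qed
    then show "k = v \<cdot> shift_mor C h"
      using coproduct_eqI[OF c h'(1) h(1)] h'(2) by simp
  qed
qed

text \<open>An isomorphism is the second map of an exact triangle that starts at a zero
  object.\<close>

lemma (in triangulated_category) triangulated_subcategory_isomorphic:
  assumes "triangulated_subcategory C S" "a \<in> S" "isomorphic C a b"
  shows "b \<in> S"
proof -
  obtain z where z: "z \<in> S" "is_zero C z"
    using assms(1) by (auto simp: triangulated_subcategory_def)
  obtain u where "u \<in> Hom C a b" "iso C u"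
    using assms(3) by (auto simp: isomorphic_def)
  from exact_triangle_iso[OF this z(2)] show ?thesis
    using assms(1,2) z(1) unfolding triangulated_subcategory_def by blast
qed

subsection \<open>Symmetric monoidal categories\<close>

context symmetric_monoidal_category
begin

lemma tens_iso:
  assumes "f \<in> Hom C a b" "iso C f" "g \<in> Hom C a' b'" "iso C g"
  shows "iso C (f \<odot> g)"
proof -
  note o = HomD[OF assms(1)] HomD[OF assms(3)]
  obtain f' where f': "f' \<in> Hom C b a" "f' \<cdot> f = ident C a" "f \<cdot> f' = ident C b"
    using assms isoE by metis
  obtain g' where g': "g' \<in> Hom C b' a'" "g' \<cdot> g = ident C a'" "g \<cdot> g' = ident C b'"
    using assms isoE by metis
  show ?thesis
  proof (rule isoI)
    show "f \<odot> g \<in> Hom C (a \<boxtimes> a') (b \<boxtimes> b')" "f' \<odot> g' \<in> Hom C (b \<boxtimes> b') (a \<boxtimes> a')"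
      using assms f' g' tens_Hom by blast+
    show "f' \<odot> g' \<cdot> (f \<odot> g) = ident C (a \<boxtimes> a')"
      using tens_cmp[OF assms(1) f'(1) assms(3) g'(1)] f' g' tens_ident o by simp
    show "f \<odot> g \<cdot> (f' \<odot> g') = ident C (b \<boxtimes> b')"
      using tens_cmp[OF f'(1) assms(1) g'(1) assms(3)] f' g' tens_ident o by simp
  qed
qed

lemma tens_isomorphic:
  assumes "isomorphic C a b" "isomorphic C a' b'"
  shows "isomorphic C (a \<boxtimes> a') (b \<boxtimes> b')"
  using assms tens_iso tens_Hom unfolding isomorphic_def by blast

lemma isomorphic_refl: "a \<in> obj C \<Longrightarrow> isomorphic C a a"
  unfolding isomorphic_def using ident_Hom iso_ident by blast

lemma assoc_isomorphic:
  "\<lbrakk>a \<in> obj C; b \<in> obj C; c \<in> obj C\<rbrakk> \<Longrightarrow> isomorphic C ((a \<boxtimes> b) \<boxtimes> c) (a \<boxtimes> (b \<boxtimes> c))"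
  unfolding isomorphic_def using assoc_iso by blast

lemma braid_isomorphic:
  assumes "a \<in> obj C" "b \<in> obj C"
  shows "isomorphic C (a \<boxtimes> b) (b \<boxtimes> a)"
  using isoI[OF braid_Hom[OF assms] braid_Hom[OF assms(2,1)]] braid_symmetric assms braid_Hom
  unfolding isomorphic_def by blast

lemma lunit_isomorphic: "a \<in> obj C \<Longrightarrow> isomorphic C (tunit C \<boxtimes> a) a"
  unfolding isomorphic_def using lunit_iso by blast

lemma runit_isomorphic: "a \<in> obj C \<Longrightarrow> isomorphic C (a \<boxtimes> tunit C) a"
  unfolding isomorphic_def using runit_iso by blast

text \<open>This is what makes the kernel of a functor \<open>a \<boxtimes> -\<close> absorb tensor
  factors.\<close>

lemma tens_left_commute:
  assumes "a \<in> obj C" "x \<in> obj C" "y \<in> obj C"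
  shows "isomorphic C (a \<boxtimes> (x \<boxtimes> y)) (x \<boxtimes> (a \<boxtimes> y))"
proof -
  have "isomorphic C (a \<boxtimes> (x \<boxtimes> y)) ((a \<boxtimes> x) \<boxtimes> y)"
    using assoc_isomorphic isomorphic_sym assms by blast
  also have "isomorphic C \<dots> ((x \<boxtimes> a) \<boxtimes> y)"
    using tens_isomorphic braid_isomorphic isomorphic_refl assms by blast
  also have "isomorphic C \<dots> (x \<boxtimes> (a \<boxtimes> y))"
    using assoc_isomorphic assms by blast
  finally show ?thesis .
qed

text \<open>Naturality of the left unit makes tensoring with the unit conjugate to the identity
  functor.\<close>

lemma tunit_tens_faithful:
  assumes "f \<in> Hom C a b" "g \<in> Hom C a b" "ident C (tunit C) \<odot> f = ident C (tunit C) \<odot> g"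
  shows "f = g"
proof (rule iso_cancel_right)
  show "iso C (lunit C a)" "lunit C a \<in> Hom C (tunit C \<boxtimes> a) a"
    using lunit_iso HomD assms by blast+
  show "f \<cdot> lunit C a = g \<cdot> lunit C a"
    using lunit_natural assms by metis
qed (use assms in auto)

lemma tens_tunit_faithful:
  assumes "f \<in> Hom C a b" "g \<in> Hom C a b" "f \<odot> ident C (tunit C) = g \<odot> ident C (tunit C)"
  shows "f = g"
proof (rule iso_cancel_right)
  show "iso C (runit C a)" "runit C a \<in> Hom C (a \<boxtimes> tunit C) a"
    using runit_iso HomD assms by blast+
  show "f \<cdot> runit C a = g \<cdot> runit C a"
    using runit_natural assms by metis
qed (use assms in auto)

text \<open>
  Kelly's argument: by the pentagon for \<open>\<one>, \<one>, b, c\<close> both sides agree after tensoring with \<open>\<one>\<close>.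
\<close>

lemma lunit_tens:
  assumes b: "b \<in> obj C" and c: "c \<in> obj C"
  shows "lunit C (b \<boxtimes> c) \<cdot> assoc C (tunit C) b c = lunit C b \<odot> ident C c"
proof -
  define I where "I = tunit C"
  define l where "l = lunit C"
  define r where "r = runit C"
  define \<alpha> where "\<alpha> = assoc C"
  define \<iota> where "\<iota> = ident C"
  have I: "I \<in> obj C" "I \<boxtimes> b \<in> obj C" "I \<boxtimes> I \<in> obj C" "b \<boxtimes> c \<in> obj C"
    using tunit_obj tens_obj b c by (simp_all add: I_def)
  have l: "l x \<in> Hom C (I \<boxtimes> x) x" if "x \<in> obj C" for x
    using lunit_iso that by (simp add: l_def I_def)
  have r: "r x \<in> Hom C (x \<boxtimes> I) x" if "x \<in> obj C" for x
    using runit_iso that by (simp add: r_def I_def)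
  have \<alpha>: "\<alpha> x y z \<in> Hom C ((x \<boxtimes> y) \<boxtimes> z) (x \<boxtimes> (y \<boxtimes> z))" "iso C (\<alpha> x y z)"
    if "x \<in> obj C" "y \<in> obj C" "z \<in> obj C" for x y z
    using assoc_iso that by (simp_all add: \<alpha>_def)
  have \<iota>: "\<iota> x \<in> Hom C x x" "iso C (\<iota> x)" if "x \<in> obj C" for x
    using ident_Hom iso_ident that by (simp_all add: \<iota>_def)
  \<comment> \<open>\<open>\<theta>\<close> consists of the first two arrows on the long side of the
    pentagon for \<open>I\<close>, \<open>I\<close>, \<open>b\<close>, \<open>c\<close>. Being
    invertible, it is cancelled at the end.\<close>
  define \<theta> where "\<theta> = \<alpha> I (I \<boxtimes> b) c \<cdot> (\<alpha> I I b \<odot> \<iota> c)"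
  have \<alpha>2: "\<alpha> I I b \<odot> \<iota> c \<in> Hom C (((I \<boxtimes> I) \<boxtimes> b) \<boxtimes> c) ((I \<boxtimes> (I \<boxtimes> b)) \<boxtimes> c)"
      "iso C (\<alpha> I I b \<odot> \<iota> c)"
    using tens_Hom[OF \<alpha>(1) \<iota>(1)] tens_iso[OF \<alpha> \<iota>] I b c by simp_all
  have \<theta>: "\<theta> \<in> Hom C (((I \<boxtimes> I) \<boxtimes> b) \<boxtimes> c) (I \<boxtimes> ((I \<boxtimes> b) \<boxtimes> c))" "iso C \<theta>"
    unfolding \<theta>_def
    using cmp_Hom[OF \<alpha>2(1) \<alpha>(1)[OF I(1,2) c]] iso_cmp[OF \<alpha>2(2,1) \<alpha>(2)[OF I(1,2) c] \<alpha>(1)[OF I(1,2) c]]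
    by simp_all
  have lb: "l b \<odot> \<iota> c \<in> Hom C ((I \<boxtimes> b) \<boxtimes> c) (b \<boxtimes> c)"
    using tens_Hom[OF l[OF b] \<iota>(1)[OF c]] .
  have la: "l (b \<boxtimes> c) \<cdot> \<alpha> I b c \<in> Hom C ((I \<boxtimes> b) \<boxtimes> c) (b \<boxtimes> c)"
    using cmp_Hom[OF \<alpha>(1)[OF I(1) b c] l[OF I(4)]] .
  have split: "\<iota> I \<odot> (g \<cdot> f) = (\<iota> I \<odot> g) \<cdot> (\<iota> I \<odot> f)" if "f \<in> Hom C x y" "g \<in> Hom C y z" for f g x y z
    using tens_cmp[OF \<iota>(1)[OF I(1)] \<iota>(1)[OF I(1)] that] cmp_ident[OF \<iota>(1)[OF I(1)]]
    by (simp add: \<iota>_def)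
  have "(\<iota> I \<odot> (l (b \<boxtimes> c) \<cdot> \<alpha> I b c)) \<cdot> \<theta> = ((\<iota> I \<odot> l (b \<boxtimes> c)) \<cdot> (\<iota> I \<odot> \<alpha> I b c)) \<cdot> \<theta>"
    using split[OF \<alpha>(1)[OF I(1) b c] l[OF I(4)]] by simp
  also have "\<dots> = (\<iota> I \<odot> l (b \<boxtimes> c)) \<cdot> ((\<iota> I \<odot> \<alpha> I b c) \<cdot> \<theta>)"
    using cmp_assoc[OF \<theta>(1) tens_Hom[OF \<iota>(1)[OF I(1)] \<alpha>(1)[OF I(1) b c]]
        tens_Hom[OF \<iota>(1)[OF I(1)] l[OF I(4)]]] .
  also have "(\<iota> I \<odot> \<alpha> I b c) \<cdot> \<theta> = (\<iota> I \<odot> \<alpha> I b c) \<cdot> \<alpha> I (I \<boxtimes> b) c \<cdot> (\<alpha> I I b \<odot> \<iota> c)"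
    unfolding \<theta>_def
    using cmp_assoc[OF \<alpha>2(1) \<alpha>(1)[OF I(1,2) c] tens_Hom[OF \<iota>(1)[OF I(1)] \<alpha>(1)[OF I(1) b c]]]
    by simp
  also have "\<dots> = \<alpha> I I (b \<boxtimes> c) \<cdot> \<alpha> (I \<boxtimes> I) b c"
    using pentagon[of I I b c] I b c by (simp add: \<alpha>_def \<iota>_def)
  also have "(\<iota> I \<odot> l (b \<boxtimes> c)) \<cdot> \<dots> = ((\<iota> I \<odot> l (b \<boxtimes> c)) \<cdot> \<alpha> I I (b \<boxtimes> c)) \<cdot> \<alpha> (I \<boxtimes> I) b c"
    using cmp_assoc[OF \<alpha>(1)[OF I(3) b c] \<alpha>(1)[OF I(1,1,4)] tens_Hom[OF \<iota>(1)[OF I(1)] l[OF I(4)]]]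
    by simp
  also have "(\<iota> I \<odot> l (b \<boxtimes> c)) \<cdot> \<alpha> I I (b \<boxtimes> c) = r I \<odot> \<iota> (b \<boxtimes> c)"
    using triangle[of I "b \<boxtimes> c"] I by (simp add: \<alpha>_def \<iota>_def l_def r_def I_def)
  also have "\<iota> (b \<boxtimes> c) = \<iota> b \<odot> \<iota> c"
    using tens_ident b c by (simp add: \<iota>_def)
  also have "(r I \<odot> (\<iota> b \<odot> \<iota> c)) \<cdot> \<alpha> (I \<boxtimes> I) b c = \<alpha> I b c \<cdot> ((r I \<odot> \<iota> b) \<odot> \<iota> c)"
    using assoc_natural[OF r[OF I(1)] \<iota>(1)[OF b] \<iota>(1)[OF c]] by (simp add: \<alpha>_def)
  also have "r I \<odot> \<iota> b = (\<iota> I \<odot> l b) \<cdot> \<alpha> I I b"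
    using triangle[of I b] I b by (simp add: \<alpha>_def \<iota>_def l_def r_def I_def)
  also have "((\<iota> I \<odot> l b) \<cdot> \<alpha> I I b) \<odot> \<iota> c = ((\<iota> I \<odot> l b) \<odot> \<iota> c) \<cdot> (\<alpha> I I b \<odot> \<iota> c)"
    using tens_cmp[OF \<alpha>(1)[OF I(1,1) b] tens_Hom[OF \<iota>(1)[OF I(1)] l[OF b]]
        \<iota>(1)[OF c] \<iota>(1)[OF c]] cmp_ident[OF \<iota>(1)[OF c]] by (simp add: \<iota>_def)
  also have "\<alpha> I b c \<cdot> \<dots> = (\<alpha> I b c \<cdot> ((\<iota> I \<odot> l b) \<odot> \<iota> c)) \<cdot> (\<alpha> I I b \<odot> \<iota> c)"
    using cmp_assoc[OF \<alpha>2(1) tens_Hom[OF tens_Hom[OF \<iota>(1)[OF I(1)] l[OF b]] \<iota>(1)[OF c]]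
        \<alpha>(1)[OF I(1) b c]] by simp
  also have "\<alpha> I b c \<cdot> ((\<iota> I \<odot> l b) \<odot> \<iota> c) = (\<iota> I \<odot> (l b \<odot> \<iota> c)) \<cdot> \<alpha> I (I \<boxtimes> b) c"
    using assoc_natural[OF \<iota>(1)[OF I(1)] l[OF b] \<iota>(1)[OF c]] by (simp add: \<alpha>_def)
  also have "\<dots> \<cdot> (\<alpha> I I b \<odot> \<iota> c) = (\<iota> I \<odot> (l b \<odot> \<iota> c)) \<cdot> \<theta>"
    unfolding \<theta>_def
    using cmp_assoc[OF \<alpha>2(1) \<alpha>(1)[OF I(1,2) c] tens_Hom[OF \<iota>(1)[OF I(1)] lb]] .
  finally have "\<iota> I \<odot> (l (b \<boxtimes> c) \<cdot> \<alpha> I b c) = \<iota> I \<odot> (l b \<odot> \<iota> c)"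
    using iso_cancel_right[OF \<theta>(2,1) tens_Hom[OF \<iota>(1)[OF I(1)] la] tens_Hom[OF \<iota>(1)[OF I(1)] lb]]
    by blast
  then show ?thesis
    using tunit_tens_faithful[OF la lb] by (simp add: I_def l_def \<alpha>_def \<iota>_def)
qed

text \<open>Naturality of the left unit at \<open>lunit C I\<close> gives
  \<open>lunit C (I \<boxtimes> I) = ident C I \<odot> lunit C I\<close>. With
  \<open>lunit_tens\<close> and the triangle axiom both unit maps agree after tensoring with
  \<open>I\<close>, which is faithful.\<close>

lemma lunit_tunit: "lunit C (tunit C) = runit C (tunit C)"
proof -
  define I where "I = tunit C"
  have I: "I \<in> obj C" "I \<boxtimes> I \<in> obj C"
    using tunit_obj tens_obj by (simp_all add: I_def)
  have l: "lunit C I \<in> Hom C (I \<boxtimes> I) I" "iso C (lunit C I)"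
    using lunit_iso[OF I(1)] by (simp_all add: I_def)
  have r: "runit C I \<in> Hom C (I \<boxtimes> I) I"
    using runit_iso[OF I(1)] by (simp_all add: I_def)
  have "lunit C I \<cdot> lunit C (I \<boxtimes> I) = lunit C I \<cdot> (ident C I \<odot> lunit C I)"
    using lunit_natural[OF l(1)] by (simp add: I_def)
  then have "lunit C (I \<boxtimes> I) = ident C I \<odot> lunit C I"
    using iso_cancel_left[OF l(2,1) conjunct1[OF lunit_iso[OF I(2), folded I_def]]
        tens_Hom[OF ident_Hom[OF I(1)] l(1)]] by blast
  then have "lunit C I \<odot> ident C I = runit C I \<odot> ident C I"
    using lunit_tens[OF I(1) I(1)] triangle[OF I(1) I(1)] by (simp add: I_def)
  then show ?thesis
    using tens_tunit_faithful l(1) r by (simp add: I_def)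
qed

text \<open>The unit is its own dual, with \<open>lunit\<close> as evaluation and the inverse of
  \<open>lunit\<close> as coevaluation. By rigidity this makes the unit compact.\<close>

lemma dualizable_tunit: "dualizable C (tunit C)"
proof -
  define I where "I = tunit C"
  define u where "u = lunit C I"
  define \<alpha> where "\<alpha> = assoc C I I I"
  have I: "I \<in> obj C"
    using tunit_obj by (simp add: I_def)
  have u: "u \<in> Hom C (I \<boxtimes> I) I" "iso C u" "runit C I = u"
    using lunit_iso[OF I] lunit_tunit by (simp_all add: I_def u_def)
  obtain v where v: "v \<in> Hom C I (I \<boxtimes> I)" "v \<cdot> u = ident C (I \<boxtimes> I)" "u \<cdot> v = ident C I"
    using isoE[OF u(2,1)] by blast
  have \<alpha>: "\<alpha> \<in> Hom C ((I \<boxtimes> I) \<boxtimes> I) (I \<boxtimes> (I \<boxtimes> I))" "iso C \<alpha>"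
    using assoc_iso I by (simp_all add: \<alpha>_def)
  obtain \<beta> where \<beta>: "\<beta> \<in> Hom C (I \<boxtimes> (I \<boxtimes> I)) ((I \<boxtimes> I) \<boxtimes> I)" "\<beta> \<cdot> \<alpha> = ident C ((I \<boxtimes> I) \<boxtimes> I)"
      "\<alpha> \<cdot> \<beta> = ident C (I \<boxtimes> (I \<boxtimes> I))"
    using isoE[OF \<alpha>(2,1)] by blast
  have inv: "inv_mor C \<alpha> = \<beta>"
    using inv_mor_eq[OF \<alpha>(1) \<beta>] .
  note i = ident_Hom[OF I]
  have tri: "(ident C I \<odot> u) \<cdot> \<alpha> = u \<odot> ident C I"
    using triangle[OF I I] u(3) by (simp add: u_def \<alpha>_def I_def)
  have "u \<cdot> (ident C I \<odot> u) \<cdot> \<alpha> \<cdot> (v \<odot> ident C I) = u \<cdot> (u \<odot> ident C I) \<cdot> (v \<odot> ident C I)"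
    using cmp_assoc[OF \<alpha>(1) tens_Hom[OF i u(1)] u(1)] tri by simp
  also have "\<dots> = u \<cdot> ((u \<odot> ident C I) \<cdot> (v \<odot> ident C I))"
    using cmp_assoc[OF tens_Hom[OF v(1) i] tens_Hom[OF u(1) i] u(1)] .
  also have "\<dots> = u"
    using tens_cmp[OF v(1) u(1) i i] v(3) cmp_ident[OF i] tens_ident[OF I I] cmp_ident[OF u(1)] by simp
  finally have 1: "u \<cdot> (ident C I \<odot> u) \<cdot> \<alpha> \<cdot> (v \<odot> ident C I) = u" .
  \<comment> \<open>The triangle identity \<open>tri\<close> is moved across the inverse associator,
    the form that the second duality equation needs.\<close>
  have "(u \<odot> ident C I) \<cdot> \<beta> = (ident C I \<odot> u) \<cdot> (\<alpha> \<cdot> \<beta>)"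
    using cmp_assoc[OF \<beta>(1) \<alpha>(1) tens_Hom[OF i u(1)]] tri by simp
  also have "\<dots> = ident C I \<odot> u"
    using \<beta>(3) cmp_ident[OF tens_Hom[OF i u(1)]] by simp
  finally have "u \<cdot> (u \<odot> ident C I) \<cdot> \<beta> \<cdot> (ident C I \<odot> v) = u \<cdot> (ident C I \<odot> u) \<cdot> (ident C I \<odot> v)"
    using cmp_assoc[OF \<beta>(1) tens_Hom[OF u(1) i] u(1)] by simp
  also have "\<dots> = u \<cdot> ((ident C I \<odot> u) \<cdot> (ident C I \<odot> v))"
    using cmp_assoc[OF tens_Hom[OF i v(1)] tens_Hom[OF i u(1)] u(1)] .
  also have "\<dots> = u"
    using tens_cmp[OF i i v(1) u(1)] v(3) cmp_ident[OF i] tens_ident[OF I I] cmp_ident[OF u(1)] by simp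
  finally have 2: "u \<cdot> (u \<odot> ident C I) \<cdot> \<beta> \<cdot> (ident C I \<odot> v) = u" .
  have "dualizable C I"
    unfolding dualizable_def
    using I u(1) v(1) 1 2 u(3) inv by (intro conjI bexI[of _ I] bexI[of _ v] bexI[of _ u])
      (simp_all add: u_def[symmetric] \<alpha>_def[symmetric] I_def[symmetric])
  then show ?thesis
    by (simp add: I_def)
qed

end

subsection \<open>The compact part\<close>

context rigidly_compactly_generated
begin

text \<open>The common kernel of the functors \<open>a \<boxtimes> -\<close>. The two extreme cases
  are \<open>A = obj T\<close>, which gives the zero objects, and \<open>A = {}\<close>, which gives
  the whole category.\<close>

definition annihilator :: "'o set \<Rightarrow> 'o set" where
  "annihilator A = {s \<in> obj T. \<forall>a \<in> A. is_zero T (a \<boxtimes> s)}"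

lemma is_zero_tens_right:
  assumes "a \<in> obj T" "is_zero T z"
  shows "is_zero T (a \<boxtimes> z)"
  using tens_exact_left[OF assms(1)] is_zero_functor[OF _ assms(2), of "\<lambda>x. a \<boxtimes> x"]
  by (auto simp: exact_endofunctor_def)

text \<open>Each \<open>a \<boxtimes> -\<close> is exact and preserves small coproducts, its kernel
  absorbs tensor factors by \<open>tens_left_commute\<close>, and intersections keep all these
  closure properties.\<close>

lemma localizing_ideal_annihilator:
  assumes A: "A \<subseteq> obj T"
  shows "localizing_ideal \<kappa> T (annihilator A)"
  unfolding localizing_ideal_def
proof (intro conjI allI impI ballI)
  have sub: "triangulated_subcategory T {s \<in> obj T. is_zero T (a \<boxtimes> s)}" if "a \<in> A" for a
    using kernel_triangulated[OF tens_exact_left] that A by blast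
  obtain z where z: "is_zero T z"
    using ex_zero by blast
  have "z \<in> annihilator A"
    using z is_zero_obj is_zero_tens_right A by (auto simp: annihilator_def)
  moreover have "shift_obj T x \<in> annihilator A \<longleftrightarrow> x \<in> annihilator A" if "x \<in> obj T" for x
    using sub that shift_obj by (auto simp: annihilator_def triangulated_subcategory_def)
  moreover have "w \<in> annihilator A"
    if t: "exact_triangle T x y w f g h" "x \<in> annihilator A" "y \<in> annihilator A" for x y w f g h
  proof -
    have "w \<in> obj T"
      using HomD(5)[OF exact_triangleD(2)[OF t(1)]] .
    moreover have "w \<in> {s \<in> obj T. is_zero T (a \<boxtimes> s)}" if "a \<in> A" for a
    proof -
      have "x \<in> {s \<in> obj T. is_zero T (a \<boxtimes> s)}" "y \<in> {s \<in> obj T. is_zero T (a \<boxtimes> s)}"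
        using t that by (auto simp: annihilator_def)
      then show ?thesis
        using sub[OF that] t(1) unfolding triangulated_subcategory_def by blast
    qed
    ultimately show ?thesis
      by (simp add: annihilator_def)
  qed
  ultimately show "triangulated_subcategory T (annihilator A)"
    using z unfolding triangulated_subcategory_def by (auto simp: annihilator_def)
next
  fix I :: "'k set" and X c \<iota>
  assume I: "small \<kappa> I" "is_coproduct T I X c \<iota>" "\<forall>i\<in>I. X i \<in> annihilator A"
  have "is_zero T (a \<boxtimes> c)" if "a \<in> A" for a
    using coproduct_of_zeros[OF tens_coproduct_left[OF I(1,2)]] that A I(3)
    by (auto simp: annihilator_def)
  then show "c \<in> annihilator A"
    using coproduct_obj[OF I(2)] by (simp add: annihilator_def)
next
  fix x y assume xy: "x \<in> obj T" "y \<in> annihilator A"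
  have "is_zero T (a \<boxtimes> (x \<boxtimes> y))" if "a \<in> A" for a
  proof -
    have "is_zero T (x \<boxtimes> (a \<boxtimes> y))"
      using xy is_zero_tens_right that by (auto simp: annihilator_def)
    moreover have "isomorphic T (x \<boxtimes> (a \<boxtimes> y)) (a \<boxtimes> (x \<boxtimes> y))"
      using tens_left_commute xy that A by (auto simp: annihilator_def)
    ultimately show ?thesis
      using is_zero_isomorphic by blast
  qed
  then show "x \<boxtimes> y \<in> annihilator A"
    using xy tens_obj by (simp add: annihilator_def)
qed

section \<open>Transfer between the category and its compact part\<close>

abbreviation K where "K \<equiv> compact_part \<kappa> T"

lemma compact_part_simps [simp]:
  "obj K = {x. compact_object \<kappa> T x}" "arr K = {f \<in> arr T. src T f \<in> obj K \<and> tgt T f \<in> obj K}"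
  "src K = src T" "tgt K = tgt T" "ident K = ident T" "cmp K = cmp T" "zero_mor K = zero_mor T"
  "shift_obj K = shift_obj T" "tunit K = tunit T" "tens_obj K = tens_obj T"
  by (simp_all add: compact_part_def full_subcategory_def)

lemma obj_K_subset: "x \<in> obj K \<Longrightarrow> x \<in> obj T"
  by (simp add: compact_object_def)

lemma Hom_K: "\<lbrakk>a \<in> obj K; b \<in> obj K\<rbrakk> \<Longrightarrow> Hom K a b = Hom T a b"
  by (auto simp: Hom_def)

lemma Hom_K_subset: "Hom K a b \<subseteq> Hom T a b"
  by (auto simp: Hom_def)

lemma tunit_K: "tunit T \<in> obj K"
  using compact_iff_dualizable dualizable_tunit by simp

text \<open>
  The last hypothesis is not automatic: the third map of a triangle in \<open>K\<close> must end in \<open>K\<close>.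
\<close>

lemma exact_triangle_K:
  assumes "exact_triangle T x y z f g h" "x \<in> obj K" "y \<in> obj K" "z \<in> obj K" "shift_obj T x \<in> obj K"
  shows "exact_triangle K x y z f g h"
proof -
  note t = exact_triangleD[OF assms(1)]
  have "(f, g, h) \<in> triangles K"
    using assms HomD[OF t(1)] HomD[OF t(2)]
    by (simp add: compact_part_def full_subcategory_def exact_triangle_def)
  moreover have "candidate_triangle K x y z f g h"
    using t Hom_K assms(2-5) unfolding candidate_triangle_def by simp
  ultimately show ?thesis
    by (simp add: exact_triangle_def)
qed

text \<open>A zero object of \<open>K\<close> has a single endomorphism. Fullness carries this over
  to \<open>T\<close>, where identity and zero then coincide.\<close>

lemma is_zero_K_imp:
  assumes "is_zero K z"
  shows "is_zero T z"
proof -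
  have z: "z \<in> obj K" "\<exists>!f. f \<in> Hom K z z"
    using assms by (auto simp: is_zero_def)
  then have "\<exists>!f. f \<in> Hom T z z"
    using Hom_K by simp
  then show ?thesis
    using is_zero_iff ident_Hom zero_mor_Hom obj_K_subset[OF z(1)] by blast
qed

lemma is_zero_K: "\<lbrakk>is_zero T z; z \<in> obj K\<rbrakk> \<Longrightarrow> is_zero K z"
  unfolding is_zero_def using Hom_K obj_K_subset by metis

lemma isomorphic_K_imp: "isomorphic K a b \<Longrightarrow> isomorphic T a b"
  unfolding isomorphic_def iso_def inverse_mors_def using Hom_K_subset by fastforce

lemma is_coproduct_K:
  assumes "is_coproduct T I X c \<iota>" "c \<in> obj K" "\<And>i. i \<in> I \<Longrightarrow> X i \<in> obj K"
  shows "is_coproduct K I X c \<iota>"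
  unfolding is_coproduct_def
proof (intro conjI ballI allI impI)
  show "X i \<in> obj K" "\<iota> i \<in> Hom K (X i) c" if "i \<in> I" for i
    using assms that Hom_K[OF assms(3)[OF that] assms(2)] by (auto simp: is_coproduct_def)
  show "c \<in> obj K"
    by fact
  fix d f assume d: "d \<in> obj K" and f: "\<forall>i\<in>I. f i \<in> Hom K (X i) d"
  then have "\<forall>i\<in>I. f i \<in> Hom T (X i) d"
    using Hom_K_subset by blast
  then show "\<exists>!h. h \<in> Hom K c d \<and> (\<forall>i\<in>I. h \<cdot>\<^bsub>K\<^esub> \<iota> i = f i)"
    using assms(1) obj_K_subset[OF d] Hom_K[OF assms(2) d] unfolding is_coproduct_def by simp
qed

lemma thick_ideal_subset: "thick_ideal K P \<Longrightarrow> P \<subseteq> obj K"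
  by (simp add: thick_ideal_def triangulated_subcategory_def)

lemma thick_ideal_shift: "\<lbrakk>thick_ideal K P; x \<in> obj K\<rbrakk> \<Longrightarrow> shift_obj T x \<in> P \<longleftrightarrow> x \<in> P"
  by (simp add: thick_ideal_def triangulated_subcategory_def)

lemma thick_ideal_triangle:
  assumes "thick_ideal K P" "exact_triangle T x y z f g h" "x \<in> P" "y \<in> P" "z \<in> obj K"
  shows "z \<in> P"
proof -
  have "x \<in> obj K" "y \<in> obj K"
    using thick_ideal_subset assms by blast+
  \<comment> \<open>\<open>P\<close> is closed under the shift and consists of compact objects. This
    supplies the last hypothesis of \<open>exact_triangle_K\<close>.\<close>
  moreover have "shift_obj T x \<in> obj K"
    using thick_ideal_shift[OF assms(1)] \<open>x \<in> obj K\<close> assms(3) thick_ideal_subset[OF assms(1)] by blast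
  ultimately have "exact_triangle K x y z f g h"
    using exact_triangle_K assms(2,5) by blast
  then show ?thesis
    using assms(1,3,4) unfolding thick_ideal_def triangulated_subcategory_def by blast
qed

lemma thick_ideal_ex_zero:
  assumes "thick_ideal K P"
  obtains z where "z \<in> P" "is_zero T z"
  using assms is_zero_K_imp unfolding thick_ideal_def triangulated_subcategory_def by blast

lemma thick_ideal_isomorphic:
  assumes "thick_ideal K P" "a \<in> P" "isomorphic T a b" "b \<in> obj K"
  shows "b \<in> P"
proof -
  obtain z where z: "z \<in> P" "is_zero T z"
    using thick_ideal_ex_zero[OF assms(1)] .
  obtain u where "u \<in> Hom T a b" "iso T u"
    using assms(3) by (auto simp: isomorphic_def)
  from thick_ideal_triangle[OF assms(1) exact_triangle_iso[OF this z(2)] z(1)] show ?thesis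
    using assms by blast
qed

lemma thick_ideal_zero: "\<lbrakk>thick_ideal K P; is_zero T z; z \<in> obj K\<rbrakk> \<Longrightarrow> z \<in> P"
  using thick_ideal_isomorphic zero_isomorphic_zero by (metis thick_ideal_ex_zero)

lemma thick_ideal_tens: "\<lbrakk>thick_ideal K P; x \<in> obj K; y \<in> P\<rbrakk> \<Longrightarrow> x \<boxtimes> y \<in> P"
  by (simp add: thick_ideal_def)

lemma Spc_thick_ideal: "P \<in> Spc K \<Longrightarrow> thick_ideal K P"
  by (simp add: Spc_def prime_ideal_def)

lemma tunit_notin_prime:
  assumes "P \<in> Spc K"
  shows "tunit T \<notin> P"
proof
  assume 1: "tunit T \<in> P"
  have th: "thick_ideal K P"
    using Spc_thick_ideal assms .
  have "x \<in> P" if "x \<in> obj K" for x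
    using thick_ideal_isomorphic[OF th thick_ideal_tens[OF th that 1] runit_isomorphic that]
      obj_K_subset[OF that] .
  then show False
    using assms thick_ideal_subset[OF th] unfolding Spc_def prime_ideal_def by blast
qed

text \<open>Primes are closed under isomorphism, so a prime is determined by its trace on the set
  \<open>S\<close> of representatives, and \<open>Pow S\<close> is small. Smallness permits a
  coproduct indexed by primes.\<close>

lemma small_Spc: "small \<kappa> (Spc K)"
  including cardinal_syntax
proof -
  obtain S where S: "S \<subseteq> obj K" "small \<kappa> (Pow S)" "\<forall>x \<in> obj K. \<exists>s \<in> S. isomorphic K x s"
    using compact_essentially_small unfolding essentially_small_def by blast
  have "P \<subseteq> Q" if "P \<in> Spc K" "Q \<in> Spc K" "P \<inter> S = Q \<inter> S" for P Q
  proof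
    fix x assume x: "x \<in> P"
    then have xK: "x \<in> obj K"
      using thick_ideal_subset Spc_thick_ideal that by blast
    then obtain s where s: "s \<in> S" "isomorphic T x s"
      using S isomorphic_K_imp by blast
    then have "s \<in> P"
      using thick_ideal_isomorphic[OF Spc_thick_ideal[OF that(1)] x] S by blast
    then have "s \<in> Q"
      using s that by blast
    then show "x \<in> Q"
      using thick_ideal_isomorphic[OF Spc_thick_ideal[OF that(2)] _ isomorphic_sym[OF s(2)] xK] by blast
  qed
  then have "inj_on (\<lambda>P. P \<inter> S) (Spc K)"
    unfolding inj_on_def by (metis subset_antisym)
  moreover have "(\<lambda>P. P \<inter> S) ` Spc K \<subseteq> Pow S"
    by blast
  ultimately have "|Spc K| \<le>o |Pow S|"
    using card_of_ordLeq by blast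
  then show ?thesis
    using S(2) ordLeq_ordLess_trans unfolding small_def by blast
qed

end

subsection \<open>Finite coproducts of compact objects\<close>

context additive_category
begin

lemma finprod_cmp:
  assumes "finite A" "u \<in> Hom C a b" "d \<in> obj C" "\<And>i. i \<in> A \<Longrightarrow> f i \<in> Hom C b d"
  shows "finprod (hom_group C b d) f A \<cdot> u = finprod (hom_group C a d) (\<lambda>i. f i \<cdot> u) A"
proof -
  note ab = HomD(4,5)[OF assms(2)]
  interpret B: comm_group "hom_group C b d"
    using hom_comm_group ab assms by blast
  interpret A: comm_group "hom_group C a d"
    using hom_comm_group ab assms by blast
  show ?thesis
    using assms(1,4)
  proof (induction A rule: finite_induct)
    case empty
    show ?case
      unfolding A.finprod_empty B.finprod_empty
      using zero_mor_cmp[OF assms(2,3)] by (simp add: hom_group_def)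
  next
    case (insert i A)
    have f: "f i \<in> Hom C b d" "f \<in> A \<rightarrow> carrier (hom_group C b d)"
      and fu: "f i \<cdot> u \<in> Hom C a d" "(\<lambda>i. f i \<cdot> u) \<in> A \<rightarrow> carrier (hom_group C a d)"
      using insert.prems cmp_Hom[OF assms(2)] by (auto simp: hom_group_def)
    have "finprod (hom_group C b d) f (insert i A) = madd C (f i) (finprod (hom_group C b d) f A)"
      using B.finprod_insert[OF insert.hyps f(2)] f(1) by (simp add: hom_group_def)
    moreover have "finprod (hom_group C b d) f A \<in> Hom C b d"
      using B.finprod_closed[OF f(2)] by (simp add: hom_group_def)
    moreover have "finprod (hom_group C a d) (\<lambda>i. f i \<cdot> u) (insert i A)
        = madd C (f i \<cdot> u) (finprod (hom_group C a d) (\<lambda>i. f i \<cdot> u) A)"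
      using A.finprod_insert[OF insert.hyps fu(2)] fu(1) by (simp add: hom_group_def)
    ultimately show ?case
      using madd_cmp[OF assms(2) f(1)] insert by simp
  qed
qed

text \<open>A family of maps out of \<open>c\<close> amounts to one family out of each
  \<open>X b\<close>, compatibly with the canonical maps, so bijectivity passes from the components
  to \<open>c\<close>. Direct sums thereby stay in the compact part.\<close>

lemma compact_object_coproduct:
  fixes \<kappa> :: "'k rel"
  assumes c: "is_coproduct C B X c \<iota>" and "finite B"
    and X: "\<And>b. b \<in> B \<Longrightarrow> compact_object \<kappa> C (X b)"
  shows "compact_object \<kappa> C c"
  unfolding compact_object_def
proof (intro conjI allI impI)
  show cobj: "c \<in> obj C"
    using coproduct_obj[OF c] .
  fix I :: "'k set" and Y d j
  assume I: "small \<kappa> I" and d: "is_coproduct C I Y d j"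
  have dobj: "d \<in> obj C" and j: "\<And>i. i \<in> I \<Longrightarrow> j i \<in> Hom C (Y i) d" "\<And>i. i \<in> I \<Longrightarrow> Y i \<in> obj C"
    using d by (auto simp: is_coproduct_def)
  \<comment> \<open>\<open>supp\<close>, \<open>fam\<close> and \<open>\<Phi>\<close> are the index
    support, the direct sum and the canonical map from the definition of compactness, with the
    source \<open>a\<close> as a parameter.\<close>
  define supp where "supp = (\<lambda>a g. {i \<in> I. g i \<noteq> zero_mor C a (Y i)})"
  define fam where "fam = (\<lambda>a. {g \<in> \<Pi>\<^sub>E i \<in> I. Hom C a (Y i). finite (supp a g)})"
  define \<Phi> where "\<Phi> = (\<lambda>a g. finprod (hom_group C a d) (\<lambda>i. j i \<cdot> g i) (supp a g))"
  have bij: "bij_betw (\<Phi> (X b)) (fam (X b)) (Hom C (X b) d)" if "b \<in> B" for b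
    using X[OF that, unfolded compact_object_def, THEN conjunct2, rule_format, OF I d]
    unfolding \<Phi>_def fam_def supp_def .
  \<comment> \<open>Naturality of \<open>\<Phi>\<close> in the source. Precomposition may shrink the
    support, but the lost indices contribute zero.\<close>
  have restrict: "restrict (\<lambda>i. g i \<cdot> u) I \<in> fam a" "\<Phi> a (restrict (\<lambda>i. g i \<cdot> u) I) = \<Phi> c g \<cdot> u"
    if u: "u \<in> Hom C a c" and g: "g \<in> fam c" for a u g
  proof -
    note a = HomD(4)[OF u]
    interpret A: comm_group "hom_group C a d"
      using hom_comm_group a dobj by blast
    have gi: "g i \<in> Hom C c (Y i)" if "i \<in> I" for i
      using g that by (auto simp: fam_def)
    let ?gu = "restrict (\<lambda>i. g i \<cdot> u) I"
    have sub: "supp a ?gu \<subseteq> supp c g"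
      using zero_mor_cmp[OF u j(2)] by (auto simp: supp_def)
    have fin: "finite (supp c g)"
      using g by (simp add: fam_def)
    show "?gu \<in> fam a"
      using cmp_Hom[OF u gi] finite_subset[OF sub fin] by (auto simp: fam_def)
    have jgu: "j i \<cdot> g i \<cdot> u = j i \<cdot> ?gu i" if "i \<in> I" for i
      using cmp_assoc[OF u gi j(1)] that by simp
    have jg: "j i \<cdot> g i \<in> Hom C c d" if "i \<in> I" for i
      using cmp_Hom[OF gi j(1)] that by blast
    have "\<Phi> a ?gu = finprod (hom_group C a d) (\<lambda>i. j i \<cdot> g i \<cdot> u) (supp c g)"
      unfolding \<Phi>_def
    proof (rule A.finprod_mono_neutral_cong_left[OF fin sub])
      fix i assume "i \<in> supp c g - supp a ?gu"
      then have i: "i \<in> I" "?gu i = zero_mor C a (Y i)"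
        by (auto simp: supp_def)
      have "j i \<cdot> g i \<cdot> u = j i \<cdot> zero_mor C a (Y i)"
        using jgu i by metis
      then show "j i \<cdot> g i \<cdot> u = \<one>\<^bsub>hom_group C a d\<^esub>"
        using cmp_zero_mor[OF j(1)[OF i(1)] a] by (simp add: hom_group_def)
    next
      fix i assume "i \<in> supp a ?gu"
      then show "j i \<cdot> ?gu i = j i \<cdot> g i \<cdot> u"
        using jgu by (auto simp: supp_def)
    next
      show "(\<lambda>i. j i \<cdot> g i \<cdot> u) \<in> supp c g \<rightarrow> carrier (hom_group C a d)"
        using cmp_Hom[OF u jg] by (auto simp: supp_def hom_group_def)
    qed
    also have "\<dots> = \<Phi> c g \<cdot> u"
      unfolding \<Phi>_def using finprod_cmp[OF fin u dobj] jg by (simp add: supp_def)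
    finally show "\<Phi> a ?gu = \<Phi> c g \<cdot> u" .
  qed
  have \<iota>: "\<iota> b \<in> Hom C (X b) c" if "b \<in> B" for b
    using coproduct_component[OF c that] .
  have mem: "\<Phi> c g \<in> Hom C c d" if g: "g \<in> fam c" for g
  proof -
    interpret G: comm_group "hom_group C c d"
      using hom_comm_group cobj dobj by blast
    have "(\<lambda>i. j i \<cdot> g i) \<in> supp c g \<rightarrow> carrier (hom_group C c d)"
      using g cmp_Hom[OF _ j(1)] by (auto simp: fam_def supp_def hom_group_def PiE_iff)
    then show ?thesis
      using G.finprod_closed by (simp add: \<Phi>_def hom_group_def)
  qed
  have "bij_betw (\<Phi> c) (fam c) (Hom C c d)"
  proof (rule bij_betw_imageI)
    show "inj_on (\<Phi> c) (fam c)"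
    proof (rule inj_onI)
      fix g h assume g: "g \<in> fam c" and h: "h \<in> fam c" and gh: "\<Phi> c g = \<Phi> c h"
      have eq: "restrict (\<lambda>i. g i \<cdot> \<iota> b) I = restrict (\<lambda>i. h i \<cdot> \<iota> b) I" if "b \<in> B" for b
      proof -
        have "\<Phi> (X b) (restrict (\<lambda>i. g i \<cdot> \<iota> b) I) = \<Phi> (X b) (restrict (\<lambda>i. h i \<cdot> \<iota> b) I)"
          unfolding restrict(2)[OF \<iota>[OF that] g] restrict(2)[OF \<iota>[OF that] h] gh ..
        then show ?thesis
          by (rule inj_onD[OF bij_betw_imp_inj_on[OF bij[OF that]]])
            (rule restrict(1)[OF \<iota>[OF that]], fact)+
      qed
      have e: "g i \<cdot> \<iota> b = h i \<cdot> \<iota> b" if "b \<in> B" "i \<in> I" for b i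
        using fun_cong[OF eq[OF that(1)], of i] that(2) by simp
      have "g i = h i" if "i \<in> I" for i
        using coproduct_eqI[OF c, of "g i" "Y i" "h i"] g h e that by (auto simp: fam_def)
      then show "g = h"
        using g h PiE_ext unfolding fam_def by blast
    qed
    show "\<Phi> c ` fam c = Hom C c d"
    proof (intro equalityI subsetI)
      fix f assume f: "f \<in> Hom C c d"
      have "\<exists>g. g \<in> fam (X b) \<and> \<Phi> (X b) g = f \<cdot> \<iota> b" if b: "b \<in> B" for b
      proof -
        have "f \<cdot> \<iota> b \<in> \<Phi> (X b) ` fam (X b)"
          unfolding bij_betw_imp_surj_on[OF bij[OF b]] using cmp_Hom[OF \<iota>[OF b] f] .
        then show ?thesis
          by (elim imageE) (rule exI, rule conjI, assumption, erule sym)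
      qed
      then obtain g where g: "\<And>b. b \<in> B \<Longrightarrow> g b \<in> fam (X b)" "\<And>b. b \<in> B \<Longrightarrow> \<Phi> (X b) (g b) = f \<cdot> \<iota> b"
        by metis
      \<comment> \<open>For fixed \<open>i\<close> the maps \<open>g b i\<close> glue along the
        coproduct to one map out of \<open>c\<close>.\<close>
      have "\<exists>k. k \<in> Hom C c (Y i) \<and> (\<forall>b\<in>B. k \<cdot> \<iota> b = g b i)" if i: "i \<in> I" for i
      proof -
        have "g b i \<in> Hom C (X b) (Y i)" if "b \<in> B" for b
          using g(1)[OF that] i by (auto simp: fam_def PiE_iff)
        from coproduct_cotuple[OF c j(2)[OF i] this] show ?thesis
          by metis
      qed
      then obtain k0 where k0: "\<And>i. i \<in> I \<Longrightarrow> k0 i \<in> Hom C c (Y i)"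
          "\<And>i b. i \<in> I \<Longrightarrow> b \<in> B \<Longrightarrow> k0 i \<cdot> \<iota> b = g b i"
        by metis
      define k where "k = restrict k0 I"
      \<comment> \<open>A nonzero map out of \<open>c\<close> is nonzero on some component, so
        finitely many finite supports bound that of \<open>k\<close>.\<close>
      have "supp c k \<subseteq> (\<Union>b\<in>B. supp (X b) (g b))"
      proof
        fix i assume "i \<in> supp c k"
        then have i: "i \<in> I" "k0 i \<noteq> zero_mor C c (Y i)"
          by (auto simp: supp_def k_def)
        show "i \<in> (\<Union>b\<in>B. supp (X b) (g b))"
        proof (rule ccontr)
          assume "i \<notin> (\<Union>b\<in>B. supp (X b) (g b))"
          then have "g b i = zero_mor C (X b) (Y i)" if "b \<in> B" for b
            using i(1) that by (auto simp: supp_def)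
          then have "k0 i \<cdot> \<iota> b = zero_mor C c (Y i) \<cdot> \<iota> b" if "b \<in> B" for b
            using that k0(2)[OF i(1) that] zero_mor_cmp[OF \<iota>[OF that] j(2)[OF i(1)]] by simp
          then show False
            using coproduct_eqI[OF c k0(1)[OF i(1)] zero_mor_Hom[OF cobj j(2)[OF i(1)]]] i(2) by blast
        qed
      qed
      moreover have "finite (\<Union>b\<in>B. supp (X b) (g b))"
        using g(1) \<open>finite B\<close> by (simp add: fam_def)
      ultimately have k: "k \<in> fam c"
        using k0(1) finite_subset by (auto simp: fam_def k_def)
      have "\<Phi> c k = f"
      proof (rule coproduct_eqI[OF c mem[OF k] f])
        fix b assume b: "b \<in> B"
        have "restrict (\<lambda>i. k i \<cdot> \<iota> b) I = g b"
          using g(1)[OF b] k0(2) b by (auto simp: fam_def k_def fun_eq_iff PiE_iff extensional_def)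
        then show "\<Phi> c k \<cdot> \<iota> b = f \<cdot> \<iota> b"
          using restrict(2)[OF \<iota>[OF b] k] g(2)[OF b] by simp
      qed
      then show "f \<in> \<Phi> c ` fam c"
        using k by blast
    qed (use mem in blast)
  qed
  then show "bij_betw (\<lambda>g. finprod (hom_group C c d) (\<lambda>i. j i \<cdot> g i) {i \<in> I. g i \<noteq> zero_mor C c (Y i)})
      {g \<in> \<Pi>\<^sub>E i \<in> I. Hom C c (Y i). finite {i \<in> I. g i \<noteq> zero_mor C c (Y i)}} (Hom C c d)"
    unfolding \<Phi>_def fam_def supp_def .
qed

end

subsection \<open>The constructible topology on the spectrum\<close>

text \<open>Subsets of \<open>'a\<close> are the points of a power of the discrete two-point space,
  compact by Tychonoff, so the infinite family has an accumulation point. Agreement on a finite set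
  is a neighbourhood there.\<close>

lemma infinite_family_accumulation:
  fixes \<S> :: "'a set set"
  assumes "infinite \<S>"
  obtains Q where "\<And>F. finite F \<Longrightarrow> \<exists>P \<in> \<S>. P \<noteq> Q \<and> P \<inter> F = Q \<inter> F"
proof -
  define X where "X = product_topology (\<lambda>_::'a. discrete_topology (UNIV::bool set)) UNIV"
  define \<chi> where "\<chi> = (\<lambda>(P::'a set) x. x \<in> P)"
  have inj: "inj \<chi>"
    by (auto simp: \<chi>_def inj_def fun_eq_iff)
  have top: "topspace X = UNIV"
    by (simp add: X_def)
  have "compactin X UNIV"
    using compact_space_product_topology[of "\<lambda>_::'a. discrete_topology (UNIV::bool set)" UNIV]
    by (simp add: compact_space_discrete_topology flip: top) (simp add: X_def compact_space_def)
  moreover have "infinite (\<chi> ` \<S>)"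
    using assms inj by (meson finite_imageD inj_on_subset subset_UNIV)
  ultimately obtain q where q: "q \<in> X derived_set_of (\<chi> ` \<S>)"
    using compactin_imp_Bolzano_Weierstrass[of X UNIV "\<chi> ` \<S>"] by blast
  show thesis
  proof (rule that)
    fix F :: "'a set" assume F: "finite F"
    \<comment> \<open>The cylinder around \<open>q\<close> that fixes the coordinates in
      \<open>F\<close>.\<close>
    define U where "U = (\<lambda>i. if i \<in> F then {q i} else UNIV)"
    have "{i. U i \<noteq> UNIV} \<subseteq> F"
      by (auto simp: U_def)
    then have "openin X (Pi\<^sub>E UNIV U)"
      using F unfolding X_def by (intro product_topology_basis) (auto intro: finite_subset)
    moreover have "q \<in> Pi\<^sub>E UNIV U"
      by (auto simp: U_def PiE_iff)
    ultimately obtain P where P: "P \<in> \<S>" "\<chi> P \<noteq> q" "\<chi> P \<in> Pi\<^sub>E UNIV U"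
      using q unfolding in_derived_set_of by blast
    have "x \<in> P \<longleftrightarrow> q x" if "x \<in> F" for x
      using P(3) that by (auto simp: \<chi>_def U_def PiE_iff split: if_splits)
    moreover have "P \<noteq> {x. q x}"
      using P(2) by (auto simp: \<chi>_def)
    ultimately show "\<exists>P\<in>\<S>. P \<noteq> {x. q x} \<and> P \<inter> F = {x. q x} \<inter> F"
      using P(1) by (intro bexI[of _ P]) auto
  qed
qed

section \<open>Open sets of the spectrum, finitely generated primes and limits of primes\<close>

context rigidly_compactly_generated
begin

text \<open>Thickness gives one direction, and the split triangle on \<open>x\<close> and
  \<open>y\<close> the other. This makes the sets of primes containing a given object stable under
  intersection.\<close>

lemma direct_sum_mem_iff:
  assumes "is_coproduct T UNIV (\<lambda>i::bool. if i then x else y) c \<iota>"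
    and "x \<in> obj K" "y \<in> obj K" "thick_ideal K P"
  shows "c \<in> P \<longleftrightarrow> x \<in> P \<and> y \<in> P"
proof
  have "compact_object \<kappa> T c"
    by (rule compact_object_coproduct[OF assms(1)]) (use assms(2,3) in auto)
  then have cK: "c \<in> obj K"
    by simp
  have KK: "(if i then x else y) \<in> obj K" "(if i then y else x) \<in> obj K" for i
    using assms(2,3) by simp_all
  have "direct_summand K x c" "direct_summand K y c"
    unfolding direct_summand_def
    using is_coproduct_K[OF assms(1) cK KK(1)]
      is_coproduct_K[OF binary_coproduct_swap[OF assms(1)] cK KK(2)] assms(2,3) by blast+
  then show "x \<in> P \<and> y \<in> P" if "c \<in> P"
    using that assms(4) unfolding thick_ideal_def by blast
  show "c \<in> P" if xy: "x \<in> P \<and> y \<in> P"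
  proof -
    have s: "shift_obj T x \<in> P" "shift_obj T y \<in> P"
      using thick_ideal_shift[OF assms(4)] assms(2,3) xy by blast+
    have "compact_object \<kappa> T (shift_obj T c)"
      by (rule compact_object_coproduct[OF shift_coproduct[OF assms(1)]])
        (use s thick_ideal_subset[OF assms(4)] in auto)
    then have sc: "shift_obj T c \<in> obj K"
      by simp
    obtain f g h where "exact_triangle T x c y f g h"
      using split_triangle[OF assms(1)] by blast
    \<comment> \<open>\<open>thick_ideal\<close> only puts third terms of triangles into \<open>P\<close>, hence the detour through \<open>\<Sigma>c\<close>.\<close>
    then have "shift_obj T c \<in> P"
      using thick_ideal_triangle[OF assms(4) exact_rotate[OF exact_rotate] _ s(1) sc] xy by blast
    then show ?thesis
      using thick_ideal_shift[OF assms(4) cK] by blast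
  qed
qed

text \<open>A value of \<open>topology\<close> can be unfolded only for an actual topology, which
  requires the basic sets to be stable under intersection. Two basic sets meet in the basic set of
  the direct sum.\<close>

lemma openin_Spc:
  "openin (Spc_topology K) U \<longleftrightarrow> (\<exists>X \<subseteq> obj K. U = (\<Union>x \<in> X. {Q \<in> Spc K. x \<in> Q}))"
proof -
  define B where "B = (\<lambda>U. \<exists>x \<in> obj K. U = Spc K - supp K x)"
  have basic: "Spc K - supp K x = {Q \<in> Spc K. x \<in> Q}" for x
    by (auto simp: supp_def)
  have "istopology (arbitrary union_of B)"
  proof (rule istopology_base)
    fix U V assume "B U" "B V"
    then obtain x y where xy: "x \<in> obj K" "y \<in> obj K" "U = {Q \<in> Spc K. x \<in> Q}" "V = {Q \<in> Spc K. y \<in> Q}"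
      unfolding B_def basic by blast
    obtain c \<iota> where c: "is_coproduct T UNIV (\<lambda>i::bool. if i then x else y) c \<iota>"
      using ex_binary_coproduct xy(1,2) obj_K_subset by blast
    have "compact_object \<kappa> T c"
      by (rule compact_object_coproduct[OF c]) (use xy(1,2) in auto)
    then have "c \<in> obj K"
      by simp
    moreover have "U \<inter> V = {Q \<in> Spc K. c \<in> Q}"
      using direct_sum_mem_iff[OF c xy(1,2)] Spc_thick_ideal xy(3,4) by blast
    ultimately show "B (U \<inter> V)"
      unfolding B_def basic by blast
  qed
  then have "openin (Spc_topology K) = arbitrary union_of B"
    unfolding Spc_topology_def B_def[symmetric] by (rule topology_inverse')
  moreover have "(arbitrary union_of B) U \<longleftrightarrow> (\<exists>X \<subseteq> obj K. U = (\<Union>x \<in> X. {Q \<in> Spc K. x \<in> Q}))"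
  proof
    assume "(arbitrary union_of B) U"
    \<comment> \<open>The index set is chosen as large as possible: all objects whose basic set lies
      in \<open>U\<close>.\<close>
    then have "U = (\<Union>x \<in> {x \<in> obj K. {Q \<in> Spc K. x \<in> Q} \<subseteq> U}. {Q \<in> Spc K. x \<in> Q})"
      unfolding arbitrary_union_of_alt B_def basic by blast
    moreover have "{x \<in> obj K. {Q \<in> Spc K. x \<in> Q} \<subseteq> U} \<subseteq> obj K"
      by blast
    ultimately show "\<exists>X \<subseteq> obj K. U = (\<Union>x \<in> X. {Q \<in> Spc K. x \<in> Q})"
      by meson
  next
    assume "\<exists>X \<subseteq> obj K. U = (\<Union>x \<in> X. {Q \<in> Spc K. x \<in> Q})"
    then show "(arbitrary union_of B) U"
      unfolding arbitrary_union_of_alt B_def basic by blast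
  qed
  ultimately show ?thesis
    by simp
qed

lemma topspace_Spc_subset: "topspace (Spc_topology K) \<subseteq> Spc K"
  using openin_topspace[of "Spc_topology K"] unfolding openin_Spc by blast

text \<open>Basic open sets are defined by membership of an object in the prime, so passing to a
  larger prime is generization.\<close>

lemma openin_Spc_upward:
  "\<lbrakk>openin (Spc_topology K) U; P \<in> U; P \<subseteq> Q; Q \<in> Spc K\<rbrakk> \<Longrightarrow> Q \<in> U"
  unfolding openin_Spc by blast

lemma compactin_Spc:
  assumes "openin (Spc_topology K) U" "compactin (Spc_topology K) U"
  obtains Y where "finite Y" "U = (\<Union>y \<in> Y. {Q \<in> Spc K. y \<in> Q})"
proof -
  obtain X where X: "X \<subseteq> obj K" "U = (\<Union>x \<in> X. {Q \<in> Spc K. x \<in> Q})"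
    using assms(1) openin_Spc by blast
  let ?D = "\<lambda>x. {Q \<in> Spc K. x \<in> Q}"
  have "openin (Spc_topology K) (?D x)" if "x \<in> X" for x
    unfolding openin_Spc using that X(1) by (intro exI[of _ "{x}"]) auto
  then have "Ball (?D ` X) (openin (Spc_topology K))" "U \<subseteq> \<Union>(?D ` X)"
    using X(2) by blast+
  then obtain \<F> where \<F>: "finite \<F>" "\<F> \<subseteq> ?D ` X" "U \<subseteq> \<Union>\<F>"
    using assms(2) unfolding compactin_def by meson
  obtain Y where "Y \<subseteq> X" "finite Y" "\<F> = ?D ` Y"
    using finite_subset_image[OF \<F>(1,2)] by blast
  then show thesis
    using that[of Y] X(2) \<F>(3) by blast
qed

text \<open>For finite \<open>X\<close> this turns the inclusion of \<open>P\<close> in a prime into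
  a test on finitely many objects.\<close>

lemma prime_contains_radical:
  assumes "P \<in> Spc K" "Q \<in> Spc K" "X \<subseteq> Q" "P = radical K (generated_ideal K X)"
  shows "P \<subseteq> Q"
proof
  \<comment> \<open>The powers of \<open>x\<close> are compact because \<open>P\<close> absorbs compact factors and lies in \<open>obj K\<close>.\<close>
  fix x assume x: "x \<in> P"
  note th = Spc_thick_ideal[OF assms(1)]
  obtain n where n: "n \<ge> 1" "tens_pow K x n \<in> generated_ideal K X" and xK: "x \<in> obj K"
    using x assms(4) unfolding radical_def by blast
  have pow: "tens_pow K x (Suc m) \<in> obj K" for m
  proof (induction m)
    case (Suc m)
    then show ?case
      using thick_ideal_tens[OF th Suc x] thick_ideal_subset[OF th] by auto
  qed (use xK in simp)
  have "tens_pow K x (Suc m) \<in> Q \<Longrightarrow> x \<in> Q" for m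
  proof (induction m)
    case (Suc m)
    then show ?case
      using assms(2) xK pow[of m] unfolding Spc_def prime_ideal_def by auto
  qed simp
  moreover have "tens_pow K x n \<in> Q"
    using n(2) assms(2,3) Spc_thick_ideal unfolding generated_ideal_def by blast
  ultimately show "x \<in> Q"
    using n(1) by (cases n) auto
qed

lemma generators_subset_radical:
  assumes "X \<subseteq> obj K"
  shows "X \<subseteq> radical K (generated_ideal K X)"
proof
  fix x assume "x \<in> X"
  then have "x \<in> obj K" "tens_pow K x (Suc 0) \<in> generated_ideal K X"
    using assms by (auto simp: generated_ideal_def)
  then show "x \<in> radical K (generated_ideal K X)"
    unfolding radical_def by (auto intro!: exI[of _ "Suc 0"])
qed

text \<open>Agreement on the generators \<open>X\<close> forces \<open>P \<subseteq> Q\<close>,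
  which keeps \<open>Q\<close> in every open set around \<open>P\<close> and so outside
  \<open>W2\<close>. Agreement on \<open>Y\<close> keeps \<open>Q\<close> outside the open set
  \<open>U\<close>, hence inside \<open>W1\<close>.\<close>

lemma patch_isolated:
  assumes P: "P \<in> Spc K" and "weakly_visible (Spc_topology K) {P}" "finitely_generated K P"
  obtains F where "finite F" "\<And>Q. \<lbrakk>Q \<in> Spc K; P \<inter> F = Q \<inter> F\<rbrakk> \<Longrightarrow> Q = P"
proof -
  let ?X = "Spc_topology K"
  obtain W1 W2 where W: "thomason ?X W1" "thomason ?X W2" "{P} = W1 \<inter> (topspace ?X - W2)"
    using assms(2) unfolding weakly_visible_def by blast
  obtain \<U> where \<U>: "\<And>U. U \<in> \<U> \<Longrightarrow> openin ?X U" "W2 = (\<Union>U \<in> \<U>. topspace ?X - U)"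
    using W(2) unfolding thomason_def by blast
  \<comment> \<open>One closed piece of \<open>W1\<close> through \<open>P\<close> suffices. Its
    complement \<open>U\<close> is quasi-compact, so membership in \<open>U\<close> is decided by
    finitely many objects.\<close>
  obtain U where U: "openin ?X U" "compactin ?X U" "P \<in> topspace ?X - U" "topspace ?X - U \<subseteq> W1"
  proof -
    have "P \<in> W1"
      using W(3) by blast
    moreover obtain \<V> where "\<And>V. V \<in> \<V> \<Longrightarrow> openin ?X V \<and> compactin ?X V" "W1 = (\<Union>V \<in> \<V>. topspace ?X - V)"
      using W(1) unfolding thomason_def by blast
    ultimately show thesis
      using that by blast
  qed
  obtain Y where Y: "finite Y" "U = (\<Union>y \<in> Y. {Q \<in> Spc K. y \<in> Q})"
    using compactin_Spc[OF U(1,2)] .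
  obtain X where X: "finite X" "X \<subseteq> obj K" "P = radical K (generated_ideal K X)"
    using assms(3) unfolding finitely_generated_def by blast
  show thesis
  proof (rule that)
    show "finite (X \<union> Y)"
      using X Y by blast
    fix Q assume Q: "Q \<in> Spc K" "P \<inter> (X \<union> Y) = Q \<inter> (X \<union> Y)"
    have "X \<subseteq> Q"
      using generators_subset_radical[OF X(2)] X(3) Q(2) by blast
    then have PQ: "P \<subseteq> Q"
      using prime_contains_radical[OF P Q(1)] X(3) by blast
    have "Q \<in> topspace ?X"
      using openin_Spc_upward[OF openin_topspace _ PQ Q(1)] U(3) by blast
    moreover have "Q \<notin> U"
      using U(3) Y(2) P Q by blast
    moreover have "Q \<notin> W2"
      using openin_Spc_upward[OF \<U>(1) _ PQ Q(1)] \<U>(2) W(3) by blast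
    ultimately show "Q = P"
      using U(4) W(3) by blast
  qed
qed

text \<open>The spectrum is closed in the space of all sets of objects: apart from the existence of
  a zero object, each axiom of a prime concerns at most three objects at a time and is inherited
  from a prime agreeing with \<open>Q\<close> on them.\<close>

lemma limit_of_primes:
  assumes lim: "\<And>F. finite F \<Longrightarrow> \<exists>P \<in> Spc K. P \<inter> F = Q \<inter> F"
  shows "Q \<in> Spc K"
proof -
  have lim3: "\<exists>P \<in> Spc K. (x \<in> P \<longleftrightarrow> x \<in> Q) \<and> (y \<in> P \<longleftrightarrow> y \<in> Q) \<and> (z \<in> P \<longleftrightarrow> z \<in> Q)" for x y z
    using lim[of "{x, y, z}"] by blast
  have sub: "Q \<subseteq> obj K"
    using lim3 Spc_thick_ideal thick_ideal_subset by blast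
  \<comment> \<open>A zero object taken from one prime lies in every prime, hence also in
    \<open>Q\<close>.\<close>
  obtain P0 z where z: "P0 \<in> Spc K" "z \<in> P0" "is_zero T z"
    using lim3 thick_ideal_ex_zero Spc_thick_ideal by metis
  have "z \<in> obj K"
    using z thick_ideal_subset Spc_thick_ideal by blast
  then have "z \<in> Q" "is_zero K z"
    using lim3[of z z z] thick_ideal_zero[OF Spc_thick_ideal z(3)] is_zero_K[OF z(3)] by blast+
  moreover have "shift_obj T x \<in> Q \<longleftrightarrow> x \<in> Q" if "x \<in> obj K" for x
  proof -
    obtain P where "P \<in> Spc K" "x \<in> P \<longleftrightarrow> x \<in> Q" "shift_obj T x \<in> P \<longleftrightarrow> shift_obj T x \<in> Q"
      using lim3[of x "shift_obj T x" x] by blast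
    then show ?thesis
      using thick_ideal_shift[OF Spc_thick_ideal that] by blast
  qed
  moreover have "z \<in> Q" if t: "exact_triangle K x y z f g h" and xy: "x \<in> Q" "y \<in> Q" for x y z f g h
  proof -
    obtain P where "P \<in> Spc K" "x \<in> P" "y \<in> P" "z \<in> P \<longleftrightarrow> z \<in> Q"
      using lim3[of x y z] xy by blast
    moreover from \<open>P \<in> Spc K\<close> have "triangulated_subcategory K P"
      using Spc_thick_ideal unfolding thick_ideal_def by blast
    ultimately show ?thesis
      using t unfolding triangulated_subcategory_def by blast
  qed
  ultimately have "triangulated_subcategory K Q"
    using sub unfolding triangulated_subcategory_def by auto
  moreover have "x \<in> Q" if y: "y \<in> Q" and xy: "direct_summand K x y" for x y
  proof -
    obtain P where "P \<in> Spc K" "x \<in> P \<longleftrightarrow> x \<in> Q" "y \<in> P"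
      using lim3[of x y y] y by blast
    then show ?thesis
      using Spc_thick_ideal xy unfolding thick_ideal_def by blast
  qed
  moreover have "x \<boxtimes> y \<in> Q" if x: "x \<in> obj K" and y: "y \<in> Q" for x y
  proof -
    obtain P where "P \<in> Spc K" "y \<in> P" "x \<boxtimes> y \<in> P \<longleftrightarrow> x \<boxtimes> y \<in> Q"
      using lim3[of y "x \<boxtimes> y" y] y by blast
    then show ?thesis
      using thick_ideal_tens[OF Spc_thick_ideal x] by blast
  qed
  ultimately have "thick_ideal K Q"
    unfolding thick_ideal_def by simp
  moreover have "Q \<noteq> obj K"
    using lim3[of "tunit T"] tunit_notin_prime tunit_K by blast
  moreover have "x \<in> Q \<or> y \<in> Q" if xy: "x \<in> obj K" "y \<in> obj K" "x \<boxtimes> y \<in> Q" for x y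
  proof -
    obtain P where P: "P \<in> Spc K" "x \<in> P \<longleftrightarrow> x \<in> Q" "y \<in> P \<longleftrightarrow> y \<in> Q" "x \<boxtimes> y \<in> P"
      using lim3[of x y "x \<boxtimes> y"] xy(3) by blast
    then have "x \<in> P \<or> y \<in> P"
      using xy(1,2) unfolding Spc_def prime_ideal_def by auto
    then show ?thesis
      using P by blast
  qed
  ultimately show ?thesis
    unfolding Spc_def prime_ideal_def by simp
qed

lemma infinite_Spc_not_isolated:
  assumes "infinite (Spc K)"
  obtains Q where "Q \<in> Spc K" "\<And>F. finite F \<Longrightarrow> \<exists>P \<in> Spc K. P \<noteq> Q \<and> P \<inter> F = Q \<inter> F"
  using infinite_family_accumulation[OF assms] limit_of_primes by metis

end

subsection \<open>Stratification\<close>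

text \<open>The coproduct axioms range over index sets in \<open>'k\<close>, while the family needed
  below is indexed by primes. A small set embeds in \<open>Field \<kappa>\<close>.\<close>

lemma small_reindex:
  fixes \<kappa> :: "'k rel"
  assumes "smallness_cardinal \<kappa>" "small \<kappa> A"
  obtains f :: "'a \<Rightarrow> 'k" where "inj_on f A" "small \<kappa> (f ` A)"
  including cardinal_syntax
proof -
  have \<kappa>: "Card_order \<kappa>" and A: "|A| <o \<kappa>"
    using assms by (simp_all add: smallness_cardinal_def small_def)
  have "|A| \<le>o |Field \<kappa>|"
    using ordLeq_ordIso_trans[OF ordLess_imp_ordLeq[OF A] ordIso_symmetric[OF card_of_Field_ordIso[OF \<kappa>]]] .
  from iffD2[OF card_of_ordLeq this] obtain f where f: "inj_on f A" and "f ` A \<subseteq> Field \<kappa>"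
    by blast
  have "|f ` A| <o \<kappa>"
    using ordLeq_ordLess_trans[OF card_of_image A] .
  then show thesis
    using that[OF f] by (simp add: small_def)
qed

context rigidly_compactly_generated
begin

lemma small_subset:
  includes cardinal_syntax
  assumes "small \<kappa> B" "A \<subseteq> B"
  shows "small \<kappa> A"
  unfolding small_def
  using ordLeq_ordLess_trans[OF card_of_mono1[OF assms(2)] assms(1)[unfolded small_def]] .

lemma is_g_obj:
  assumes "is_g \<kappa> T W g"
  shows "g \<in> obj T"
proof -
  obtain W1 W2 e1 f1 e2 f2 where e: "idempotent_triangle \<kappa> T W1 e1 f1" "idempotent_triangle \<kappa> T W2 e2 f2"
    and g: "g = e1 \<boxtimes> f2"
    using assms unfolding is_g_def by blast
  have "e1 \<in> obj T" "f2 \<in> obj T"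
    using e HomD(4)[OF exact_triangleD(1)] HomD(5)[OF exact_triangleD(2)]
    unfolding idempotent_triangle_def by blast+
  then show ?thesis
    using tens_obj g by simp
qed

lemma localizing_ideal_subset: "localizing_ideal \<kappa> T L \<Longrightarrow> L \<subseteq> obj T"
  by (simp add: localizing_ideal_def triangulated_subcategory_def)

lemma localizing_ideal_isomorphic:
  "\<lbrakk>localizing_ideal \<kappa> T L; a \<in> L; isomorphic T a b\<rbrakk> \<Longrightarrow> b \<in> L"
  using triangulated_subcategory_isomorphic by (auto simp: localizing_ideal_def)

lemma localizing_ideal_tens: "\<lbrakk>localizing_ideal \<kappa> T L; x \<in> obj T; y \<in> L\<rbrakk> \<Longrightarrow> x \<boxtimes> y \<in> L"
  by (simp add: localizing_ideal_def)

text \<open>\<open>g \<boxtimes> y\<close> vanishes for every \<open>g\<close>, so no weakly visible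
  set through a point of the support of \<open>y\<close> has a \<open>g\<close>, and the condition
  for \<open>z\<close> holds vacuously. Emptiness does not follow at this point, since idempotent
  triangles are not shown to exist.\<close>

lemma Supp_eq_zero:
  assumes "is_zero T y" "is_zero T z"
  shows "Supp \<kappa> T y \<subseteq> Supp \<kappa> T z"
  using is_zero_tens_right[OF is_g_obj assms(1)] by (fastforce simp: Supp_def)

text \<open>A single \<open>g\<close> witnesses that \<open>P\<close> is missing, and it excludes
  \<open>P\<close> from the support of everything it kills.\<close>

lemma Supp_annihilator:
  assumes "P \<in> Spc K" "P \<notin> Supp \<kappa> T s"
  obtains g where "g \<in> obj T" "is_zero T (g \<boxtimes> s)"
    "\<And>t. is_zero T (g \<boxtimes> t) \<Longrightarrow> P \<notin> Supp \<kappa> T t"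
proof -
  obtain W g where "weakly_visible (Spc_topology K) W" "P \<in> W" "is_g \<kappa> T W g" "is_zero T (g \<boxtimes> s)"
    using assms unfolding Supp_def by blast
  then show thesis
    using that[of g] is_g_obj unfolding Supp_def by blast
qed

end

section \<open>Consequences of stratification\<close>

locale tt_stratified_category = rigidly_compactly_generated \<kappa> T
  for \<kappa> :: "'k rel" and T :: "('o, 'm, 'e) tt_category_scheme" (structure) +
  assumes stratified: "tt_stratified \<kappa> T"
begin

lemma Supp_ideal_inj:
  assumes "localizing_ideal \<kappa> T L" "localizing_ideal \<kappa> T M"
    and "(\<Union>t \<in> L. Supp \<kappa> T t) = (\<Union>t \<in> M. Supp \<kappa> T t)"
  shows "L = M"
  using stratified assms unfolding tt_stratified_def bij_betw_def inj_on_def by blast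

lemma ex_localizing_ideal_Supp:
  assumes "Y \<subseteq> Spc K"
  obtains L where "localizing_ideal \<kappa> T L" "(\<Union>t \<in> L. Supp \<kappa> T t) = Y"
proof -
  have "Y \<in> (\<lambda>L. \<Union>t \<in> L. Supp \<kappa> T t) ` {L. localizing_ideal \<kappa> T L}"
    using stratified assms unfolding tt_stratified_def bij_betw_def by blast
  then show thesis
    using that by blast
qed

text \<open>The localizing ideal with empty support contains some zero object, and all zero objects
  have the same support.\<close>

lemma Supp_zero:
  assumes "is_zero T z"
  shows "Supp \<kappa> T z = {}"
proof -
  obtain L where L: "localizing_ideal \<kappa> T L" "(\<Union>t \<in> L. Supp \<kappa> T t) = {}"
    using ex_localizing_ideal_Supp[of "{}"] by blast
  obtain y where "y \<in> L" "is_zero T y"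
    using L(1) unfolding localizing_ideal_def triangulated_subcategory_def by blast
  then show ?thesis
    using Supp_eq_zero[OF assms] L(2) by blast
qed

text \<open>Each point is missing from the support of \<open>s\<close> because of some
  \<open>g\<close> in \<open>A\<close>, which also removes it from the support of all of
  \<open>annihilator A\<close>. Injectivity identifies this ideal, which contains \<open>s\<close>,
  with the ideal of zero objects.\<close>

lemma Supp_empty_imp_zero:
  assumes s: "s \<in> obj T" and "Supp \<kappa> T s = {}"
  shows "is_zero T s"
proof -
  define A where "A = {g \<in> obj T. is_zero T (g \<boxtimes> s)}"
  have "Supp \<kappa> T t = {}" if t: "t \<in> annihilator A" for t
  proof -
    have "P \<notin> Supp \<kappa> T t" if P: "P \<in> Spc K" for P
    proof (rule Supp_annihilator[OF P])
      show "P \<notin> Supp \<kappa> T s"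
        using assms(2) by simp
      fix g assume "g \<in> obj T" "is_zero T (g \<boxtimes> s)" "\<And>t. is_zero T (g \<boxtimes> t) \<Longrightarrow> P \<notin> Supp \<kappa> T t"
      then show "P \<notin> Supp \<kappa> T t"
        using t by (simp add: A_def annihilator_def)
    qed
    then show ?thesis
      unfolding Supp_def by blast
  qed
  \<comment> \<open>The unit is among the annihilating objects, and tensoring with it changes
    nothing.\<close>
  moreover have z: "is_zero T t" if "t \<in> annihilator (obj T)" for t
    using that is_zero_isomorphic[OF lunit_isomorphic] tunit_obj by (simp add: annihilator_def)
  then have "Supp \<kappa> T t = {}" if "t \<in> annihilator (obj T)" for t
    using Supp_zero that by blast
  ultimately have "annihilator A = annihilator (obj T)"
    using localizing_ideal_annihilator[of A] localizing_ideal_annihilator[of "obj T"]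
    by (intro Supp_ideal_inj) (auto simp: A_def)
  moreover have "s \<in> annihilator A"
    using s by (simp add: A_def annihilator_def)
  ultimately show ?thesis
    using z by blast
qed

text \<open>The ideal is recorded besides \<open>t\<close> because it bounds the supports of tensor
  products with \<open>t\<close>, replacing a tensor formula for \<open>Supp\<close>.\<close>

lemma ex_singleton_Supp:
  assumes "P \<in> Spc K"
  obtains t L where "localizing_ideal \<kappa> T L" "t \<in> L" "Supp \<kappa> T t = {P}" "\<And>s. s \<in> L \<Longrightarrow> Supp \<kappa> T s \<subseteq> {P}"
proof -
  obtain L where L: "localizing_ideal \<kappa> T L" "(\<Union>t \<in> L. Supp \<kappa> T t) = {P}"
    using ex_localizing_ideal_Supp[of "{P}"] assms by blast
  then obtain t where "t \<in> L" "P \<in> Supp \<kappa> T t"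
    by blast
  then show thesis
    using that[OF L(1), of t] L(2) by blast
qed

lemma weakly_visible_point:
  assumes P: "P \<in> Spc K"
  shows "weakly_visible (Spc_topology K) {P}"
proof (rule ccontr)
  assume nv: "\<not> weakly_visible (Spc_topology K) {P}"
  have "\<exists>t L. localizing_ideal \<kappa> T L \<and> t \<in> L \<and> Supp \<kappa> T t = {Q} \<and> (\<forall>s \<in> L. Supp \<kappa> T s \<subseteq> {Q})"
    if "Q \<in> Spc K" for Q
    using ex_singleton_Supp[OF that] by metis
  then obtain t L where tL: "\<And>Q. Q \<in> Spc K \<Longrightarrow> localizing_ideal \<kappa> T (L Q)" "\<And>Q. Q \<in> Spc K \<Longrightarrow> t Q \<in> L Q"
    "\<And>Q. Q \<in> Spc K \<Longrightarrow> Supp \<kappa> T (t Q) = {Q}"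
    "\<And>Q s. \<lbrakk>Q \<in> Spc K; s \<in> L Q\<rbrakk> \<Longrightarrow> Supp \<kappa> T s \<subseteq> {Q}"
    by metis
  have obj: "t Q \<in> obj T" if "Q \<in> Spc K" for Q
    using localizing_ideal_subset[OF tL(1)[OF that]] tL(2)[OF that] by blast
  \<comment> \<open>The product lies in both ideals, so its support is contained in
    \<open>{P}\<close> and in \<open>{Q}\<close>.\<close>
  have orth: "is_zero T (t P \<boxtimes> t Q)" if Q: "Q \<in> Spc K" "Q \<noteq> P" for Q
  proof -
    have "t P \<boxtimes> t Q \<in> L Q"
      using localizing_ideal_tens tL(1,2) Q(1) obj P by blast
    moreover have "t P \<boxtimes> t Q \<in> L P"
      using localizing_ideal_isomorphic[OF tL(1)[OF P] localizing_ideal_tens[OF tL(1)[OF P]]]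
        tL(2)[OF P] braid_isomorphic obj Q(1) P by blast
    ultimately have "Supp \<kappa> T (t P \<boxtimes> t Q) = {}"
      using tL(4)[OF Q(1)] tL(4)[OF P] Q(2) by blast
    then show ?thesis
      using Supp_empty_imp_zero tens_obj obj P Q(1) by blast
  qed
  have tP: "{t P} \<subseteq> obj T"
    using obj[OF P] by simp
  note ann = localizing_ideal_annihilator[OF tP]
  have mem: "t Q \<in> annihilator {t P}" if "Q \<in> Spc K" "Q \<noteq> P" for Q
    using orth[OF that] obj[OF that(1)] by (simp add: annihilator_def)
  define J where "J = Spc K - {P}"
  have "small \<kappa> J"
    using small_subset[OF small_Spc] by (auto simp: J_def)
  then obtain f :: "'o set \<Rightarrow> 'k" where f: "inj_on f J" "small \<kappa> (f ` J)"
    using small_reindex[OF smallness] by metis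
  define X where "X = (\<lambda>i. t (inv_into J f i))"
  have Xf: "X (f Q) = t Q" if "Q \<in> J" for Q
    using f(1) that by (simp add: X_def)
  have "\<forall>i \<in> f ` J. X i \<in> obj T"
    using Xf obj by (auto simp: J_def)
  then obtain c \<iota> where c: "is_coproduct T (f ` J) X c \<iota>"
    using ex_coproduct[OF f(2)] by blast
  have "\<forall>i \<in> f ` J. X i \<in> annihilator {t P}"
    using Xf mem by (auto simp: J_def)
  then have cann: "c \<in> annihilator {t P}"
    using ann f(2) c unfolding localizing_ideal_def by blast
  \<comment> \<open>A \<open>g\<close> that kills the coproduct kills each component. Its weakly
    visible set is not \<open>{P}\<close>, so it contains some \<open>Q\<close> in \<open>J\<close>,
    and \<open>g\<close> would kill \<open>t Q\<close>.\<close>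
  have "P \<in> Supp \<kappa> T c"
  proof (rule ccontr)
    assume "P \<notin> Supp \<kappa> T c"
    then obtain W g where W: "weakly_visible (Spc_topology K) W" "P \<in> W" "is_g \<kappa> T W g" "is_zero T (g \<boxtimes> c)"
      using P unfolding Supp_def by blast
    have "W \<subseteq> Spc K"
      using W(1) topspace_Spc_subset unfolding weakly_visible_def by blast
    moreover have "W \<noteq> {P}"
      using W(1) nv by blast
    ultimately obtain Q where Q: "Q \<in> W" "Q \<in> J"
      using W(2) by (auto simp: J_def)
    have "is_zero T (g \<boxtimes> X (f Q))"
      using coproduct_zero_component[OF tens_coproduct_left[OF f(2) c is_g_obj[OF W(3)]] _ W(4)] Q(2)
      by blast
    then have "Q \<notin> Supp \<kappa> T (t Q)"
      using W(1,3) Q Xf unfolding Supp_def by fastforce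
    then show False
      using tL(3) Q(2) by (auto simp: J_def)
  qed
  \<comment> \<open>\<open>P\<close> is covered by the coproduct \<open>c\<close>, every other prime
    \<open>Q\<close> by \<open>t Q\<close>.\<close>
  then have "Spc K \<subseteq> (\<Union>s \<in> annihilator {t P}. Supp \<kappa> T s)"
    using cann mem tL(3) by blast
  moreover have "Supp \<kappa> T s \<subseteq> Spc K" for s
    unfolding Supp_def by blast
  moreover have "annihilator {t P} \<subseteq> annihilator {}"
    by (auto simp: annihilator_def)
  ultimately have "(\<Union>s \<in> annihilator {t P}. Supp \<kappa> T s) = (\<Union>s \<in> annihilator {}. Supp \<kappa> T s)"
    by blast
  \<comment> \<open>\<open>annihilator {}\<close> is the whole category and contains the unit, which
    \<open>t P\<close> must then kill.\<close>
  then have "annihilator {t P} = annihilator {}"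
    using Supp_ideal_inj[OF ann localizing_ideal_annihilator] by blast
  then have "is_zero T (t P \<boxtimes> tunit T)"
    using tunit_obj by (auto simp: annihilator_def)
  then have "is_zero T (t P)"
    using is_zero_isomorphic[OF runit_isomorphic] obj P by blast
  then show False
    using Supp_zero tL(3) P by blast
qed

end

theorem corollary10:
  fixes \<kappa> :: "'k rel" and T :: "('o, 'm) tt_category"
  assumes "rigidly_compactly_generated \<kappa> T"
    and "tt_stratified \<kappa> T"
    and "infinite (Spc (compact_part \<kappa> T))"
  shows "\<exists>P \<in> Spc (compact_part \<kappa> T). \<not> finitely_generated (compact_part \<kappa> T) P"
proof -
  interpret tt_stratified_category \<kappa> T
    using assms(1,2) by (simp add: tt_stratified_category_def tt_stratified_category_axioms_def)
  obtain Q where Q: "Q \<in> Spc K" "\<And>F. finite F \<Longrightarrow> \<exists>P \<in> Spc K. P \<noteq> Q \<and> P \<inter> F = Q \<inter> F"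
    using infinite_Spc_not_isolated[OF assms(3)] by blast
  have "\<not> finitely_generated K Q"
  proof
    assume "finitely_generated K Q"
    from patch_isolated[OF Q(1) weakly_visible_point[OF Q(1)] this]
    obtain F where "finite F" "\<And>P. \<lbrakk>P \<in> Spc K; Q \<inter> F = P \<inter> F\<rbrakk> \<Longrightarrow> P = Q"
      by blast
    then show False
      using Q(2)[of F] by metis
  qed
  then show ?thesis
    using Q(1) by blast
qed

end
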